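(* Let $n\ge 3$ and let $H$ be a finite simple connected graph with $n$ vertices and $n+1$ edges such that $H$ contains two edge-disjoint cycles. Then $N(P_H)\le M(n)$.
   Context: For a finite simple graph $G$ on vertex set $[n]$, the symmetric edge polytope is $P_G=\operatorname{conv}\{\pm(e_i-e_j):\{i,j\}\in E(G)\}\subset\mathbb{R}^n$ ($e_i$ the standard basis vectors), and $N(P)$ is the number of facets of a polytope $P$. A wedge $G\vee H$ is a graph obtained by identifying a vertex of $G$ with a vertex of $H$; $C_m$ denotes the cycle with $m$ edges and $e$ a single edge. For $n\ge 3$, $M(n)$ is defined as $N(P_G)$ where $G=C_{k+1}\vee C_{k-1}$ if $n=2k-1$ with $k$ even; $G=C_k\vee C_k$ if $n=2k-1$ with $k$ odd; $G=C_{k+1}\vee C_{k-1}\vee e$ if $n=2k$ with $k$ even; $G=C_k\vee C_k\vee e$ if $n=2k$ with $k$ odd. Explicitly, $M(2k-1)=(k+1)(k-1)\binom{k}{k/2}\binom{k-2}{(k-2)/2}$ for $k$ even, $M(2k-1)=k^2\binom{k-1}{(k-1)/2}^2$ for $k$ odd, and $M(2k)=2M(2k-1)$. *)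

theory Defs
  imports "HOL-Analysis.Analysis"
begin

text \<open>An undirected graph is a vertex set with a set of edges; the edge joining \<open>i\<close> and \<open>j\<close> is
  the set \<open>{i, j}\<close>, so that a loop at \<open>i\<close> is \<open>{i}\<close>. Loops are excluded by \<open>simple_graph\<close>.\<close>

datatype 'v ugraph = Graph (verts: "'v set") (edges: "'v set set")

definition simple_graph :: "'v ugraph \<Rightarrow> bool" where
  "simple_graph G \<longleftrightarrow> finite (verts G) \<and> (\<forall>e\<in>edges G. e \<subseteq> verts G \<and> card e = 2)"

definition connected_graph :: "'v ugraph \<Rightarrow> bool" where
  "connected_graph G \<longleftrightarrow> verts G \<noteq> {} \<and>
     (\<forall>u\<in>verts G. \<forall>v\<in>verts G. (u, v) \<in> {(x, y). {x, y} \<in> edges G}\<^sup>*)"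

definition subgraph_of :: "'v ugraph \<Rightarrow> 'v ugraph \<Rightarrow> bool" where
  "subgraph_of A G \<longleftrightarrow> verts A \<subseteq> verts G \<and> edges A \<subseteq> edges G"

text \<open>\<open>is_cycle m G\<close>: \<open>G\<close> is a copy of \<open>C\<^sub>m\<close>. For \<open>m = 1\<close> this is a single vertex with a loop,
  which occurs below only in \<open>C\<^sub>3 \<or> C\<^sub>1\<close> (\<open>n = 3\<close>) and \<open>C\<^sub>3 \<or> C\<^sub>1 \<or> e\<close> (\<open>n = 4\<close>).
  The case \<open>m = 2\<close>, where the encoding would merge the two parallel edges, is never used.\<close>

definition is_cycle :: "nat \<Rightarrow> 'v ugraph \<Rightarrow> bool" where
  "is_cycle m G \<longleftrightarrow> m \<ge> 1 \<and> (\<exists>xs. length xs = m \<and> distinct xs \<and> verts G = set xs \<and>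
     edges G = {{xs ! i, xs ! (Suc i mod m)} | i. i < m})"

definition is_single_edge :: "'v ugraph \<Rightarrow> bool" where
  "is_single_edge G \<longleftrightarrow> (\<exists>u v. u \<noteq> v \<and> G = Graph {u, v} {{u, v}})"

text \<open>\<open>is_wedge G A B\<close>: \<open>G\<close> is \<open>A \<or> B\<close>, the copies \<open>A\<close> and \<open>B\<close> being taken inside \<open>G\<close>, where they
  overlap exactly in the identified vertex.\<close>

definition is_wedge :: "'v ugraph \<Rightarrow> 'v ugraph \<Rightarrow> 'v ugraph \<Rightarrow> bool" where
  "is_wedge G A B \<longleftrightarrow> (\<exists>v. verts A \<inter> verts B = {v}) \<and>
     verts G = verts A \<union> verts B \<and> edges G = edges A \<union> edges B"

definition has_two_edge_disjoint_cycles :: "'v ugraph \<Rightarrow> bool" where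
  "has_two_edge_disjoint_cycles G \<longleftrightarrow>
     (\<exists>A B k l. k \<ge> 3 \<and> l \<ge> 3 \<and> is_cycle k A \<and> is_cycle l B \<and>
        subgraph_of A G \<and> subgraph_of B G \<and> edges A \<inter> edges B = {})"

definition sym_edge_polytope :: "'v::finite ugraph \<Rightarrow> (real ^ 'v) set" where
  "sym_edge_polytope G = convex hull
     ({axis i 1 - axis j 1 | i j. {i, j} \<in> edges G} \<union>
      {- (axis i 1 - axis j 1) | i j. {i, j} \<in> edges G})"

definition num_facets :: "'a::euclidean_space set \<Rightarrow> nat" where
  "num_facets P = card {F. F facet_of P}"

definition is_wedge_of_cycles :: "nat \<Rightarrow> nat \<Rightarrow> 'v ugraph \<Rightarrow> bool" where
  "is_wedge_of_cycles k l G \<longleftrightarrow> (\<exists>A B. is_cycle k A \<and> is_cycle l B \<and> is_wedge G A B)"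

definition is_wedge_of_cycles_edge :: "nat \<Rightarrow> nat \<Rightarrow> 'v ugraph \<Rightarrow> bool" where
  "is_wedge_of_cycles_edge k l G \<longleftrightarrow>
     (\<exists>A B. is_wedge_of_cycles k l A \<and> is_single_edge B \<and> is_wedge G A B)"

definition is_M_graph :: "nat \<Rightarrow> 'v ugraph \<Rightarrow> bool" where
  "is_M_graph n G \<longleftrightarrow> (\<exists>k.
     (n + 1 = 2 * k \<and> even k \<and> is_wedge_of_cycles (k + 1) (k - 1) G) \<or>
     (n + 1 = 2 * k \<and> odd k \<and> is_wedge_of_cycles k k G) \<or>
     (n = 2 * k \<and> even k \<and> is_wedge_of_cycles_edge (k + 1) (k - 1) G) \<or>
     (n = 2 * k \<and> odd k \<and> is_wedge_of_cycles_edge k k G))"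

text \<open>The number \<open>M(n)\<close> for \<open>n = CARD('v)\<close>. The dimension \<open>n\<close> of the ambient space is carried by the
  type, hence the type argument. The choice concerns only the labelling of the vertices and the
  vertex at which \<open>e\<close> is attached; a suitable graph exists by \<open>ex_M_graph\<close> below.\<close>

definition M_facets :: "'v::finite itself \<Rightarrow> nat" where
  "M_facets _ = num_facets (sym_edge_polytope (SOME G :: 'v ugraph. is_M_graph CARD('v) G))"

lemma ex_cycle_on:
  assumes "finite V" "card V = m" "m \<ge> 1"
  shows "\<exists>G. is_cycle m G \<and> verts G = V"
proof -
  obtain xs where xs: "set xs = V" "distinct xs"
    using finite_distinct_list[OF assms(1)] by blast
  then have "length xs = m"
    using assms(2) distinct_card by metis
  then have "is_cycle m (Graph V {{xs ! i, xs ! (Suc i mod m)} | i. i < m})"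
    unfolding is_cycle_def using xs assms(3) by (auto intro!: exI[of _ xs])
  then show ?thesis
    by (intro exI[of _ "Graph V {{xs ! i, xs ! (Suc i mod m)} | i. i < m}"] conjI) simp_all
qed

lemma ex_wedge_of_cycles_on:
  assumes "finite V" "card V + 1 = k + l" "k \<ge> 1" "l \<ge> 1"
  shows "\<exists>G. is_wedge_of_cycles k l G \<and> verts G = V"
proof -
  have "k \<le> card V" using assms by simp
  then obtain S where S: "S \<subseteq> V" "card S = k"
    using obtain_subset_with_card_n by metis
  have "S \<noteq> {}" using S(2) assms(3) by auto
  then obtain v where v: "v \<in> S" by blast
  have fS: "finite S" using S(1) assms(1) finite_subset by blast
  have "card (V - S) = l - 1"
    using card_Diff_subset[OF fS S(1)] S(2) assms(2,4) by simp
  then have c: "card (insert v (V - S)) = l"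
    using v assms(1,4) by simp
  obtain A where A: "is_cycle k A" "verts A = S"
    using ex_cycle_on[OF fS S(2) assms(3)] by blast
  obtain B where B: "is_cycle l B" "verts B = insert v (V - S)"
    using ex_cycle_on[OF _ c assms(4)] assms(1) by auto
  have "verts A \<inter> verts B = {v}" "verts A \<union> verts B = V"
    using A B v S by auto
  then have "is_wedge (Graph V (edges A \<union> edges B)) A B"
    unfolding is_wedge_def by auto
  then show ?thesis
    unfolding is_wedge_of_cycles_def using A B by (metis ugraph.sel(1))
qed

lemma ex_wedge_of_cycles_edge_on:
  assumes "finite V" "card V = k + l" "k \<ge> 1" "l \<ge> 1"
  shows "\<exists>G. is_wedge_of_cycles_edge k l G \<and> verts G = V"
proof -
  have "card V \<noteq> 0" using assms(2,3) by linarith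
  then have "V \<noteq> {}" by (metis card.empty)
  then obtain w where w: "w \<in> V" by blast
  have c: "card (V - {w}) + 1 = k + l"
    using w assms(1,2) \<open>card V \<noteq> 0\<close> by (simp add: card_Diff_singleton)
  obtain A where A: "is_wedge_of_cycles k l A" "verts A = V - {w}"
    using ex_wedge_of_cycles_on[OF _ c assms(3,4)] assms(1) by blast
  have "card (V - {w}) \<noteq> 0" using c assms by linarith
  then have "V - {w} \<noteq> {}" by (metis card.empty)
  then obtain v where v: "v \<in> V" "v \<noteq> w" by auto
  let ?B = "Graph {v, w} {{v, w}}"
  have "is_wedge (Graph V (edges A \<union> {{v, w}})) A ?B"
    unfolding is_wedge_def using A v w by auto
  moreover have "is_single_edge ?B" unfolding is_single_edge_def using v by blast
  ultimately show ?thesis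
    unfolding is_wedge_of_cycles_edge_def using A(1)
    by (intro exI[of _ "Graph V (edges A \<union> {{v, w}})"]) auto
qed

lemma ex_M_graph:
  assumes "CARD('v::finite) \<ge> 3"
  shows "\<exists>G :: 'v ugraph. is_M_graph CARD('v) G \<and> verts G = UNIV"
proof (cases "even CARD('v)")
  case True
  then obtain k where k: "CARD('v) = 2 * k" by (rule evenE)
  have k2: "k \<ge> 2" using k assms by linarith
  have "\<exists>G :: 'v ugraph. is_wedge_of_cycles_edge (k + 1) (k - 1) G \<and> verts G = UNIV"
    by (rule ex_wedge_of_cycles_edge_on) (use k k2 in simp_all)
  moreover have "\<exists>G :: 'v ugraph. is_wedge_of_cycles_edge k k G \<and> verts G = UNIV"
    by (rule ex_wedge_of_cycles_edge_on) (use k k2 in simp_all)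
  ultimately show ?thesis
    using k unfolding is_M_graph_def by metis
next
  case False
  then obtain j where j: "CARD('v) = 2 * j + 1" by (rule oddE)
  define k where "k = j + 1"
  have k: "CARD('v) + 1 = 2 * k" using j by (simp add: k_def)
  have k2: "k \<ge> 2" using k assms by linarith
  have "\<exists>G :: 'v ugraph. is_wedge_of_cycles (k + 1) (k - 1) G \<and> verts G = UNIV"
    by (rule ex_wedge_of_cycles_on) (use k k2 in simp_all)
  moreover have "\<exists>G :: 'v ugraph. is_wedge_of_cycles k k G \<and> verts G = UNIV"
    by (rule ex_wedge_of_cycles_on) (use k k2 in simp_all)
  ultimately show ?thesis
    using k unfolding is_M_graph_def by metis
qed

end

theory Submission
  imports Defs
begin

text \<open>
  A facet of \<open>P\<^sub>H\<close> is the same as a vector \<open>a\<close> in the span of the edge vectors \<open>d\<^sub>e\<close> such that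
  \<open>\<bar>a \<bullet> d\<^sub>e\<bar> \<le> 1\<close> for all edges and the tight edges (those with equality) still span. Since \<open>H\<close> is
  connected with \<open>n + 1\<close> edges, the span has codimension 2 in the number of edges, and each of the
  two edge-disjoint cycles contributes one linear relation. Comparing ranks, the tight edges span
  iff at most one edge of each cycle and no other edge fails to be tight. Hence a facet amounts to
  a free choice of sign on each edge outside the cycles, together with independent labellings of
  the two cycles. A zero-sum labelling of a \<open>C\<^sub>m\<close> by signs, with at most one label in \<open>(-1, 1)\<close>, has
  no exceptional label if \<open>m\<close> is even and exactly one, equal to 0, if \<open>m\<close> is odd. With \<open>f m\<close> the
  number of these labellings, \<open>N(P\<^sub>H) = f a * f b * 2 ^ (n + 1 - a - b)\<close>, and the same formula
  applies to the graph defining \<open>M(n)\<close>.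

  It remains to maximise this product. From \<open>f (2j + 2) \<le> 2 * f (2j + 1)\<close> and
  \<open>4 * f (2j + 1) \<le> f (2j + 3)\<close> one may take both cycles odd with at most one further edge, and as
  \<open>f (2j + 3) / f (2j + 1) = 4 + 2 / (j + 1)\<close> decreases in \<open>j\<close>, balanced lengths are optimal.
\<close>

section \<open>Facets of centrally symmetric polytopes\<close>

text \<open>The level set lies in a hyperplane missing the origin, so adjoining \<open>0\<close>
  raises the affine dimension by exactly one and turns it into the linear dimension.\<close>

lemma dim_eq_aff_dim_of_level_set:
  fixes T :: "'a::euclidean_space set"
  assumes "\<And>x. x \<in> T \<Longrightarrow> a \<bullet> x = 1"
  shows "int (dim T) = aff_dim T + 1"
proof -
  have "affine hull T \<subseteq> {x. a \<bullet> x = 1}"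
    using assms by (intro hull_minimal) (auto simp: affine_hyperplane)
  then have "0 \<notin> affine hull T"
    by auto
  then have "aff_dim (insert 0 T) = aff_dim T + 1"
    by (simp add: aff_dim_insert)
  moreover have "aff_dim (insert 0 T) = int (dim (insert 0 T))"
    by (rule aff_dim_zero) (simp add: hull_inc)
  ultimately show ?thesis
    by (metis dim_span span_insert_0)
qed

text \<open>Facet normals scaled so that the supporting hyperplane has height 1. The polytope may
  lie in a proper subspace; requiring \<open>a \<in> span S\<close> singles out one normal per
  facet.\<close>

definition facet_normals :: "'a::euclidean_space set \<Rightarrow> 'a set" where
  "facet_normals S = {a \<in> span S. (\<forall>s\<in>S. a \<bullet> s \<le> 1) \<and> span {s \<in> S. a \<bullet> s = 1} = span S}"

text \<open>Symmetry puts \<open>0\<close> in the hull and off every facet, so the supporting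
  hyperplane of a facet can be rescaled to height 1. Sending \<open>a\<close> to the face where
  \<open>a \<bullet> x = 1\<close> is then a bijection.\<close>

lemma num_facets_symmetric_convex_hull:
  fixes S :: "'a::euclidean_space set"
  assumes fin: "finite S" and sym: "\<And>s. s \<in> S \<Longrightarrow> - s \<in> S" and nz: "dim S > 0"
  shows "num_facets (convex hull S) = card (facet_normals S)"
proof -
  let ?P = "convex hull S"
  let ?F = "\<lambda>a. ?P \<inter> {x. a \<bullet> x = 1}"
  have "S \<noteq> {}" using nz by auto
  then obtain s where s: "s \<in> S" by blast
  have "(1/2) *\<^sub>R s + (1/2) *\<^sub>R (- s) \<in> ?P"
    by (rule convexD[OF convex_convex_hull]) (use s sym in \<open>auto intro: hull_inc\<close>)
  then have zero: "0 \<in> ?P" by simp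
  have PS: "?P \<subseteq> span S"
    by (rule convex_hull_subset_span)
  have dimP: "aff_dim ?P = int (dim S)"
    using aff_dim_zero[of ?P] zero
    by (metis aff_dim_convex_hull aff_dim_zero affine_hull_convex_hull hull_inc)
  have bound: "a \<bullet> x \<le> b" if "\<forall>s\<in>S. a \<bullet> s \<le> b" "x \<in> ?P" for a x b
  proof -
    have "?P \<subseteq> {x. a \<bullet> x \<le> b}"
      using that(1) by (intro hull_minimal) (auto simp: convex_halfspace_le)
    then show ?thesis using that(2) by auto
  qed
  have facet: "?F a facet_of ?P" if a: "a \<in> facet_normals S" for a
  proof -
    let ?T = "{s \<in> S. a \<bullet> s = 1}"
    have T: "\<forall>s\<in>S. a \<bullet> s \<le> 1" "span ?T = span S"
      using a unfolding facet_normals_def by auto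
    have dT: "dim ?T = dim S" using T(2) by (metis dim_span)
    have sub: "?T \<subseteq> ?F a" by (auto intro: hull_inc)
    have "?T \<noteq> {}" using dT nz by (metis dim_empty less_irrefl)
    with sub have ne: "?F a \<noteq> {}" by blast
    have "?F a face_of ?P"
      by (rule face_of_Int_supporting_hyperplane_le) (use bound T(1) in auto)
    \<comment> \<open>The tight generators already have full linear dimension; at height 1 this
      means affine dimension one less than that of the hull.\<close>
    moreover have "dim (?F a) = dim S"
    proof (rule antisym)
      show "dim (?F a) \<le> dim S" using PS by (metis dim_span dim_subset inf.coboundedI1)
      show "dim S \<le> dim (?F a)" using sub dT by (metis dim_subset)
    qed
    ultimately show ?thesis
      unfolding facet_of_def using ne dimP dim_eq_aff_dim_of_level_set[of "?F a" a] by auto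
  qed
  \<comment> \<open>Equal faces have the same tight generators, so \<open>a - b\<close> is
    orthogonal to a set whose span contains it.\<close>
  have inj: "inj_on ?F (facet_normals S)"
  proof (rule inj_onI)
    fix a b assume a: "a \<in> facet_normals S" and b: "b \<in> facet_normals S" and eq: "?F a = ?F b"
    have "{s \<in> S. a \<bullet> s = 1} = S \<inter> ?F a" by (auto intro: hull_inc)
    moreover have "{s \<in> S. b \<bullet> s = 1} = S \<inter> ?F b" by (auto intro: hull_inc)
    ultimately have T: "{s \<in> S. a \<bullet> s = 1} = {s \<in> S. b \<bullet> s = 1}" using eq by simp
    have mem: "a - b \<in> span {s \<in> S. a \<bullet> s = 1}"
      using a b unfolding facet_normals_def by (auto intro: span_diff)
    have "orthogonal (a - b) (a - b)"
    proof (rule orthogonal_to_span[OF mem])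
      fix y assume "y \<in> {s \<in> S. a \<bullet> s = 1}"
      then show "orthogonal (a - b) y"
        using T by (auto simp: orthogonal_def inner_diff_left)
    qed
    then show "a = b" by (simp add: orthogonal_self)
  qed
  have surj: "\<exists>a\<in>facet_normals S. F = ?F a" if F: "F facet_of ?P" for F
  proof -
    have Fface: "F face_of ?P" and Fdim: "aff_dim F = aff_dim ?P - 1"
      using F unfolding facet_of_def by auto
    have "F exposed_face_of ?P"
      using Fface exposed_face_of_polyhedron polytope_convex_hull[OF fin] polytope_imp_polyhedron
      by blast
    then obtain a0 b where ab: "?P \<subseteq> {x. a0 \<bullet> x \<le> b}" "F = ?P \<inter> {x. a0 \<bullet> x = b}"
      unfolding exposed_face_of_def by auto
    have "b \<ge> 0" using ab(1) zero by auto
    \<comment> \<open>At height 0, symmetry would make \<open>a0\<close> vanish on \<open>S\<close>,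
      and the facet would be the whole polytope.\<close>
    moreover have "b \<noteq> 0"
    proof
      assume b: "b = 0"
      have "a0 \<bullet> s = 0" if "s \<in> S" for s
      proof -
        have "s \<in> ?P" "- s \<in> ?P" using that sym by (auto intro: hull_inc)
        then have "a0 \<bullet> s \<le> 0" "a0 \<bullet> (- s) \<le> 0" using ab(1) b by blast+
        then show ?thesis by simp
      qed
      then have "?P \<subseteq> {x. a0 \<bullet> x = 0}"
        by (intro hull_minimal) (auto simp: convex_hyperplane)
      then have "F = ?P" using ab(2) b by auto
      then show False using Fdim by simp
    qed
    ultimately have bpos: "b > 0" by simp
    define a1 where "a1 = a0 /\<^sub>R b"
    \<comment> \<open>The component of \<open>a1\<close> orthogonal to \<open>span S\<close> does
      not affect products with points of the hull, so it is dropped.\<close>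
    obtain a z where az: "a \<in> span S" "\<And>w. w \<in> span S \<Longrightarrow> orthogonal z w" "a1 = a + z"
      using orthogonal_subspace_decomp_exists[of S a1] by blast
    have a_eq: "a \<bullet> x = (a0 \<bullet> x) / b" if "x \<in> span S" for x
    proof -
      have "a1 \<bullet> x = a \<bullet> x" using az(2)[OF that] az(3) by (simp add: orthogonal_def inner_add_left)
      then show ?thesis by (simp add: a1_def divide_inverse mult.commute)
    qed
    have FF: "F = ?F a"
      using ab(2) a_eq PS bpos by auto
    have le1: "\<forall>s\<in>S. a \<bullet> s \<le> 1"
    proof
      fix s assume "s \<in> S"
      then have "s \<in> ?P" "s \<in> span S" by (auto intro: hull_inc span_base)
      then show "a \<bullet> s \<le> 1" using ab(1) a_eq[of s] bpos by auto
    qed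
    \<comment> \<open>A face of the hull is the hull of some generators, all of them tight; counting
      their dimension gives the spanning condition.\<close>
    obtain S' where S': "S' \<subseteq> S" "F = convex hull S'"
      using face_of_convex_hull_subset[OF finite_imp_compact[OF fin] Fface] by blast
    have S'1: "a \<bullet> x = 1" if "x \<in> S'" for x
      using that S'(2) FF hull_inc[OF that, of convex] by auto
    have "int (dim S') = aff_dim S' + 1"
      by (rule dim_eq_aff_dim_of_level_set) (rule S'1)
    then have "dim S' = dim S"
      using Fdim dimP S'(2) by (simp add: aff_dim_convex_hull)
    then have "span S' = span S"
      using S'(1) by (intro subspace_dim_equal) (auto simp: span_mono)
    moreover have "span S' \<subseteq> span {s \<in> S. a \<bullet> s = 1}"
      using S'(1) S'1 by (intro span_mono) auto
    moreover have "span {s \<in> S. a \<bullet> s = 1} \<subseteq> span S"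
      by (intro span_mono) auto
    ultimately have "a \<in> facet_normals S"
      unfolding facet_normals_def using az(1) le1 by auto
    then show ?thesis using FF by blast
  qed
  have "{F. F facet_of ?P} = ?F ` facet_normals S"
    using facet surj by auto
  then show ?thesis
    unfolding num_facets_def using card_image[OF inj] by simp
qed

section \<open>Labellings of a cycle\<close>

text \<open>The values \<open>a \<bullet> d e\<close> that a facet normal \<open>a\<close> can take
  on a cycle \<open>A\<close>. Fixing the values off \<open>A\<close> by \<open>extensional\<close>
  makes these functions countable as labellings of \<open>A\<close>.\<close>

definition cycle_labellings :: "'e set \<Rightarrow> ('e \<Rightarrow> real) set" where
  "cycle_labellings A = {x \<in> extensional A. (\<forall>e\<in>A. \<bar>x e\<bar> \<le> 1) \<and> sum x A = 0 \<and>
     card {e \<in> A. \<bar>x e\<bar> \<noteq> 1} \<le> 1}"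

text \<open>For even \<open>m\<close> the positions of the labels 1 are chosen. For odd
  \<open>m\<close> first the edge labelled 0 is chosen, then the half of the remaining
  \<open>m - 1\<close> edges labelled 1.\<close>

definition cycle_facets :: "nat \<Rightarrow> nat" where
  "cycle_facets m = (if even m then m choose (m div 2) else m * ((m - 1) choose (m div 2)))"

lemma sum_signs:
  fixes x :: "'e \<Rightarrow> real"
  assumes "finite A" "\<And>e. e \<in> A \<Longrightarrow> \<bar>x e\<bar> = 1"
  shows "sum x A = 2 * real (card {e \<in> A. x e = 1}) - real (card A)"
proof -
  have "sum x A = (\<Sum>e\<in>A. (if x e = 1 then 2 else 0) - 1)"
    using assms(2) by (intro sum.cong) (force split: if_splits)+
  also have "\<dots> = (\<Sum>e\<in>A. if x e = 1 then 2 else 0) - real (card A)"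
    by (simp add: sum_subtractf)
  also have "(\<Sum>e\<in>A. if x e = 1 then 2 else 0) = (\<Sum>e\<in>{e\<in>A. x e = 1}. (2::real))"
    using assms(1) by (simp only: sum.inter_filter)
  finally show ?thesis by simp
qed

text \<open>An exceptional label is minus a sum of signs, hence an integer of absolute value below
  1, hence 0. The signs then cancel, so their number is even, and parity separates the two
  cases.\<close>

lemma cycle_labellings_cases:
  assumes fin: "finite A" and x: "x \<in> cycle_labellings A"
  shows "if even (card A) then \<forall>e\<in>A. \<bar>x e\<bar> = 1
         else \<exists>e0\<in>A. x e0 = 0 \<and> (\<forall>e\<in>A - {e0}. \<bar>x e\<bar> = 1)"
proof -
  let ?Z = "{e \<in> A. \<bar>x e\<bar> \<noteq> 1}"
  have x: "\<forall>e\<in>A. \<bar>x e\<bar> \<le> 1" "sum x A = 0" "card ?Z \<le> 1"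
    using x by (auto simp: cycle_labellings_def)
  consider "?Z = {}" | e0 where "?Z = {e0}"
  proof (cases "card ?Z = 0")
    case True
    then have "?Z = {}" using fin by simp
    then show ?thesis by (rule that(1))
  next
    case False
    then have "card ?Z = 1" using x(3) by linarith
    then show ?thesis using that(2) by (rule card_1_singletonE)
  qed
  then show ?thesis
  proof cases
    case 1
    then have s: "\<And>e. e \<in> A \<Longrightarrow> \<bar>x e\<bar> = 1" by auto
    have "real (card A) = real (2 * card {e \<in> A. x e = 1})"
      using sum_signs[OF fin s] x(2) by simp
    then have "card A = 2 * card {e \<in> A. x e = 1}" by linarith
    then show ?thesis using s by simp
  next
    case 2
    then have e0: "e0 \<in> A" "\<bar>x e0\<bar> < 1" using x(1) by force+
    have s: "\<And>e. e \<in> A - {e0} \<Longrightarrow> \<bar>x e\<bar> = 1" using 2 by auto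
    define p where "p = card {e \<in> A - {e0}. x e = 1}"
    have cA: "card A = Suc (card (A - {e0}))"
      using card_Suc_Diff1[OF fin e0(1)] by simp
    have "x e0 + sum x (A - {e0}) = 0"
      using sum.remove[OF fin e0(1), of x] x(2) by simp
    then have eq: "x e0 = of_int (int (card (A - {e0})) - 2 * int p)"
      using sum_signs[of "A - {e0}" x] fin s by (simp add: p_def)
    then have "\<bar>int (card (A - {e0})) - 2 * int p\<bar> < 1"
      using e0(2) by linarith
    then have z: "int (card (A - {e0})) - 2 * int p = 0" by linarith
    then have "card (A - {e0}) = 2 * p" by linarith
    then have "odd (card A)" using cA by simp
    moreover have "x e0 = 0" using eq z by simp
    ultimately show ?thesis using e0(1) s by auto
  qed
qed

text \<open>For even size a labelling is encoded by the set of edges labelled 1; for odd size by the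
  edge labelled 0 together with that set.\<close>

lemma card_cycle_labellings:
  assumes fin: "finite A"
  shows "card (cycle_labellings A) = cycle_facets (card A)"
proof (cases "even (card A)")
  case True
  let ?D = "{P. P \<subseteq> A \<and> card P = card A div 2}"
  let ?f = "\<lambda>P. \<lambda>e\<in>A. if e \<in> P then 1 else - 1 :: real"
  have "bij_betw ?f ?D (cycle_labellings A)"
  proof (rule bij_betw_byWitness[where f' = "\<lambda>x. {e \<in> A. x e = 1}"])
    show "\<forall>P\<in>?D. {e \<in> A. ?f P e = 1} = P"
      by (auto split: if_splits)
    show "\<forall>x\<in>cycle_labellings A. ?f {e \<in> A. x e = 1} = x"
    proof
      fix x assume x: "x \<in> cycle_labellings A"
      then have "\<forall>e\<in>A. \<bar>x e\<bar> = 1" using cycle_labellings_cases[OF fin x] True by simp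
      moreover have "x \<in> extensional A" using x by (simp add: cycle_labellings_def)
      ultimately show "?f {e \<in> A. x e = 1} = x"
        by (intro extensionalityI[of _ A]) (auto simp: abs_if split: if_splits)
    qed
    show "?f ` ?D \<subseteq> cycle_labellings A"
    proof safe
      fix P assume P: "P \<subseteq> A" "card P = card A div 2"
      have eq: "{e \<in> A. ?f P e = 1} = P" using P by (auto split: if_splits)
      have "sum (?f P) A = 2 * real (card P) - real (card A)"
        using sum_signs[OF fin, of "?f P"] eq by (simp add: if_split)
      also have "\<dots> = 0" using P(2) True by (auto simp: real_of_nat_div)
      finally have s: "sum (?f P) A = 0" .
      have "{e \<in> A. \<bar>?f P e\<bar> \<noteq> 1} = {}" by auto
      then have c: "card {e \<in> A. \<bar>?f P e\<bar> \<noteq> 1} \<le> 1" by (metis card.empty zero_le_one)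
      show "?f P \<in> cycle_labellings A"
        unfolding cycle_labellings_def mem_Collect_eq using s c by auto
    qed
    show "(\<lambda>x. {e \<in> A. x e = 1}) ` cycle_labellings A \<subseteq> ?D"
    proof (rule image_subsetI)
      fix x assume x: "x \<in> cycle_labellings A"
      then have "\<forall>e\<in>A. \<bar>x e\<bar> = 1" using cycle_labellings_cases[OF fin x] True by simp
      then have "real (card A) = real (2 * card {e \<in> A. x e = 1})"
        using sum_signs[OF fin, of x] x by (simp add: cycle_labellings_def)
      then have "card A = 2 * card {e \<in> A. x e = 1}" by linarith
      then show "{e \<in> A. x e = 1} \<in> ?D" by auto
    qed
  qed
  then have "card (cycle_labellings A) = card ?D" by (simp add: bij_betw_same_card)
  then show ?thesis using True fin by (simp add: n_subsets cycle_facets_def)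
next
  case False
  define f :: "'a \<times> 'a set \<Rightarrow> 'a \<Rightarrow> real" where
    "f p = (\<lambda>e\<in>A. if e = fst p then 0 else if e \<in> snd p then 1 else - 1)" for p
  define g :: "('a \<Rightarrow> real) \<Rightarrow> 'a \<times> 'a set" where
    "g x = (THE e0. e0 \<in> A \<and> x e0 = 0, {e \<in> A. x e = 1})" for x
  let ?D = "SIGMA e0:A. {P. P \<subseteq> A - {e0} \<and> card P = card A div 2}"
  \<comment> \<open>The zero edge is unique because all other labels are signs, so the
    \<open>THE\<close> in \<open>g\<close> is well defined.\<close>
  have g1: "g x = (e0, {e \<in> A - {e0}. x e = 1})"
    if "e0 \<in> A" "x e0 = 0" "\<forall>e\<in>A - {e0}. \<bar>x e\<bar> = 1" for x e0
  proof -
    have "(THE e0. e0 \<in> A \<and> x e0 = 0) = e0"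
      by (rule the_equality) (use that in force)+
    then show ?thesis using that by (auto simp: g_def)
  qed
  have "bij_betw f ?D (cycle_labellings A)"
  proof (rule bij_betw_byWitness[where f' = g])
    show "\<forall>p\<in>?D. g (f p) = p"
    proof
      fix p assume "p \<in> ?D"
      then obtain e0 P where p: "p = (e0, P)" and e0: "e0 \<in> A" and P: "P \<subseteq> A - {e0}"
        by auto
      have "g (f p) = (e0, {e \<in> A - {e0}. f p e = 1})"
        by (rule g1) (use e0 in \<open>auto simp: f_def p\<close>)
      also have "{e \<in> A - {e0}. f p e = 1} = P"
        using P by (auto simp: f_def p split: if_splits)
      finally show "g (f p) = p" by (simp add: p)
    qed
    show "\<forall>x\<in>cycle_labellings A. f (g x) = x"
    proof
      fix x assume x: "x \<in> cycle_labellings A"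
      then obtain e0 where e0: "e0 \<in> A" "x e0 = 0" "\<forall>e\<in>A - {e0}. \<bar>x e\<bar> = 1"
        using cycle_labellings_cases[OF fin x] False by auto
      have "x \<in> extensional A" using x by (simp add: cycle_labellings_def)
      moreover have "\<And>e. e \<in> A \<Longrightarrow> e \<noteq> e0 \<Longrightarrow> x e \<noteq> 1 \<Longrightarrow> x e = - 1" using e0(3) by force
      ultimately show "f (g x) = x"
        unfolding g1[OF e0] by (intro extensionalityI[of _ A]) (auto simp: e0 f_def)
    qed
    show "f ` ?D \<subseteq> cycle_labellings A"
    proof (rule image_subsetI)
      fix p assume "p \<in> ?D"
      then obtain e0 P where p: "p = (e0, P)" and e0: "e0 \<in> A"
        and P: "P \<subseteq> A - {e0}" "card P = card A div 2"
        by auto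
      have eq: "{e \<in> A - {e0}. f p e = 1} = P"
        using P by (auto simp: f_def p split: if_splits)
      have "card A = Suc (card (A - {e0}))" using card_Suc_Diff1[OF fin e0] by simp
      then have c2: "card (A - {e0}) = 2 * card P" using P(2) False by presburger
      have "sum (f p) A = sum (f p) (A - {e0})"
        using sum.remove[OF fin e0, of "f p"] e0 by (simp add: f_def p)
      also have "\<dots> = 2 * real (card {e \<in> A - {e0}. f p e = 1}) - real (card (A - {e0}))"
        by (rule sum_signs) (use fin in \<open>auto simp: f_def p\<close>)
      also have "\<dots> = 0" unfolding eq c2 by simp
      finally have s: "sum (f p) A = 0" .
      have "{e \<in> A. \<bar>f p e\<bar> \<noteq> 1} \<subseteq> {e0}" by (auto simp: f_def p)
      then have c: "card {e \<in> A. \<bar>f p e\<bar> \<noteq> 1} \<le> 1"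
        using card_mono[of "{e0}"] by force
      show "f p \<in> cycle_labellings A"
        unfolding cycle_labellings_def mem_Collect_eq using s c by (auto simp: f_def)
    qed
    show "g ` cycle_labellings A \<subseteq> ?D"
    proof
      fix y assume "y \<in> g ` cycle_labellings A"
      then obtain x where x: "x \<in> cycle_labellings A" and y: "y = g x" by blast
      obtain e0 where e0: "e0 \<in> A" "x e0 = 0" "\<forall>e\<in>A - {e0}. \<bar>x e\<bar> = 1"
        using cycle_labellings_cases[OF fin x] False by auto
      have "0 = sum x (A - {e0})"
        using sum.remove[OF fin e0(1), of x] e0(2) x by (simp add: cycle_labellings_def)
      also have "\<dots> = 2 * real (card {e \<in> A - {e0}. x e = 1}) - real (card (A - {e0}))"
        by (rule sum_signs) (use fin e0 in auto)
      finally have "real (card (A - {e0})) = real (2 * card {e \<in> A - {e0}. x e = 1})" by simp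
      then have "card (A - {e0}) = 2 * card {e \<in> A - {e0}. x e = 1}" by linarith
      moreover have "card A = Suc (card (A - {e0}))" using card_Suc_Diff1[OF fin e0(1)] by simp
      ultimately have "card {e \<in> A - {e0}. x e = 1} = card A div 2" by linarith
      then show "y \<in> ?D" unfolding y g1[OF e0] using e0(1) by auto
    qed
  qed
  then have "card (cycle_labellings A) = card ?D" by (simp add: bij_betw_same_card)
  also have "\<dots> = (\<Sum>e0\<in>A. card {P. P \<subseteq> A - {e0} \<and> card P = card A div 2})"
    using fin by (intro card_SigmaI) auto
  also have "\<dots> = (\<Sum>e0\<in>A. (card A - 1) choose (card A div 2))"
    using fin by (intro sum.cong) (auto simp: n_subsets)
  finally show ?thesis using False by (simp add: cycle_facets_def)
qed

section \<open>Vector configurations with two disjoint circuits\<close>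

text \<open>The relation has coefficient 1 at \<open>e\<close>, so \<open>d e\<close> is minus the
  sum over the rest of \<open>A\<close>, which stays in \<open>t - {e}\<close>.\<close>

lemma span_remove_dependent:
  fixes d :: "'e \<Rightarrow> 'a::real_vector"
  assumes "finite A" "A \<subseteq> t" "e \<in> A" "sum d A = 0"
  shows "span (d ` (t - {e})) = span (d ` t)"
proof (rule antisym)
  show "span (d ` (t - {e})) \<subseteq> span (d ` t)" by (intro span_mono) auto
  have "d e + sum d (A - {e}) = 0"
    using sum.remove[OF assms(1,3), of d] assms(4) by simp
  then have "d e = - sum d (A - {e})" by (rule eq_neg_iff_add_eq_0[THEN iffD2])
  also have "\<dots> \<in> span (d ` (t - {e}))"
    using assms(2) by (intro span_neg span_sum span_base) auto
  finally have e: "d e \<in> span (d ` (t - {e}))" .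
  have "d f \<in> span (d ` (t - {e}))" if "f \<in> t" for f
    using e that by (cases "f = e") (auto intro: span_base)
  then show "span (d ` t) \<subseteq> span (d ` (t - {e}))"
    by (intro span_minimal) auto
qed

text \<open>Model of a graph with edges \<open>E\<close>, two edge-disjoint cycles and oriented edge
  vectors \<open>d\<close>. Orienting the edges along each cycle makes its relation a plain sum; by
  \<open>dim\<close> these two relations generate all linear relations.\<close>

locale two_circuits =
  fixes E A B :: "'e set" and d :: "'e \<Rightarrow> 'a::euclidean_space"
  assumes fin: "finite E" and sub: "A \<subseteq> E" "B \<subseteq> E" and disj: "A \<inter> B = {}"
    and ne: "A \<noteq> {}" "B \<noteq> {}"
    and sum0: "sum d A = 0" "sum d B = 0"
    and dim: "dim (d ` E) + 2 = card E"
begin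

lemma finite_circuits: "finite A" "finite B"
  using fin sub finite_subset by auto

lemma span_remove_two:
  assumes "eA \<in> A" "eB \<in> B" "A \<subseteq> t" "B \<subseteq> t"
  shows "span (d ` (t - {eA, eB})) = span (d ` t)"
proof -
  have "span (d ` (t - {eA} - {eB})) = span (d ` (t - {eA}))"
    using assms disj finite_circuits sum0 by (intro span_remove_dependent[of B]) auto
  also have "\<dots> = span (d ` t)"
    using assms finite_circuits sum0 by (intro span_remove_dependent[of A]) auto
  finally show ?thesis by (simp add: Diff_insert[symmetric] insert_commute)
qed

text \<open>Each circuit contained in \<open>t\<close> makes one of its vectors redundant;
  \<open>X\<close> collects one such edge per contained circuit.\<close>

lemma dim_le_tight:
  assumes t: "t \<subseteq> E"
  shows "dim (d ` t) + (if A \<subseteq> t then 1 else 0) + (if B \<subseteq> t then 1 else 0) \<le> card t"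
proof -
  obtain eA eB where e: "eA \<in> A" "eB \<in> B" using ne by blast
  have ft: "finite t" using t fin finite_subset by auto
  have neq: "eA \<noteq> eB" using e disj by auto
  define X where "X = (if A \<subseteq> t then {eA} else {}) \<union> (if B \<subseteq> t then {eB} else {})"
  have "span (d ` (t - X)) = span (d ` t)"
    using span_remove_two[OF e, of t] span_remove_dependent[OF finite_circuits(1) _ e(1) sum0(1)]
      span_remove_dependent[OF finite_circuits(2) _ e(2) sum0(2)]
    by (auto simp: X_def insert_commute)
  then have "dim (d ` t) = dim (d ` (t - X))" by (metis dim_span)
  also have "\<dots> \<le> card (d ` (t - X))"
    using ft by (intro dim_le_card) (auto intro: span_base)
  also have "\<dots> \<le> card (t - X)" using ft by (intro card_image_le) auto
  finally have "dim (d ` t) \<le> card (t - X)" .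
  moreover have "X \<subseteq> t" using e by (auto simp: X_def)
  then have "card (t - X) + card X = card t"
    using ft by (metis card_Diff_subset card_mono finite_subset le_add_diff_inverse2)
  moreover have "card X = (if A \<subseteq> t then 1 else 0) + (if B \<subseteq> t then 1 else 0)"
    using neq by (auto simp: X_def)
  ultimately show ?thesis by simp
qed

lemma card_Diff_circuits:
  assumes t: "t \<subseteq> E"
  shows "card E = card t + card (A - t) + card (B - t) + card (E - A - B - t)"
proof -
  have f: "finite t" "finite (A - t)" "finite (B - t)" "finite (E - A - B - t)"
    using t fin finite_circuits finite_subset by auto
  have "E = t \<union> ((A - t) \<union> ((B - t) \<union> (E - A - B - t)))" using t sub by auto
  then have "card E = card (t \<union> ((A - t) \<union> ((B - t) \<union> (E - A - B - t))))" by simp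
  also have "\<dots> = card t + card ((A - t) \<union> ((B - t) \<union> (E - A - B - t)))"
    using f by (intro card_Un_disjoint) auto
  also have "card ((A - t) \<union> ((B - t) \<union> (E - A - B - t)))
      = card (A - t) + card ((B - t) \<union> (E - A - B - t))"
    using f disj by (intro card_Un_disjoint) auto
  also have "card ((B - t) \<union> (E - A - B - t)) = card (B - t) + card (E - A - B - t)"
    using f by (intro card_Un_disjoint) auto
  finally show ?thesis by simp
qed

text \<open>Forwards, the rank \<open>card E - 2\<close> is compared with the bound
  \<open>dim_le_tight\<close>. Backwards, one edge may be deleted from each circuit without
  shrinking the span.\<close>

lemma span_tight_iff:
  assumes t: "t \<subseteq> E"
  shows "span (d ` t) = span (d ` E) \<longleftrightarrow>
    card (A - t) \<le> 1 \<and> card (B - t) \<le> 1 \<and> E - A - B \<subseteq> t"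
proof
  assume "span (d ` t) = span (d ` E)"
  then have "dim (d ` t) = dim (d ` E)" by (metis dim_span)
  then have le: "card E + (if A \<subseteq> t then 1 else 0) + (if B \<subseteq> t then 1 else 0) \<le> card t + 2"
    using dim_le_tight[OF t] dim by linarith
  have z: "A \<subseteq> t \<longleftrightarrow> card (A - t) = 0" "B \<subseteq> t \<longleftrightarrow> card (B - t) = 0"
    "E - A - B \<subseteq> t \<longleftrightarrow> card (E - A - B - t) = 0"
    using finite_circuits fin by auto
  \<comment> \<open>For each circuit, the number of missing edges, plus 1 if none is missing, is at
    least 1. The total bound 2 leaves exactly 1 for each circuit and no missing edge
    elsewhere.\<close>
  show "card (A - t) \<le> 1 \<and> card (B - t) \<le> 1 \<and> E - A - B \<subseteq> t"
    using le card_Diff_circuits[OF t] unfolding z by (auto split: if_splits)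
next
  assume r: "card (A - t) \<le> 1 \<and> card (B - t) \<le> 1 \<and> E - A - B \<subseteq> t"
  \<comment> \<open>If nothing is missing from a circuit, any of its edges may be deleted
    instead.\<close>
  have pick: "\<exists>e\<in>C. C - t \<subseteq> {e}" if C: "finite C" "C \<noteq> {}" "card (C - t) \<le> 1" for C
  proof (cases "C - t = {}")
    case True
    then show ?thesis using C by auto
  next
    case False
    then have "card (C - t) = 1" using C by (metis One_nat_def card_0_eq finite_Diff le_SucE le_zero_eq)
    then show ?thesis by (metis DiffD1 card_1_singletonE insertI1 order_refl)
  qed
  obtain eA eB where e: "eA \<in> A" "A - t \<subseteq> {eA}" "eB \<in> B" "B - t \<subseteq> {eB}"
    using pick[of A] pick[of B] finite_circuits ne r by blast
  have "span (d ` E) = span (d ` (E - {eA, eB}))"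
    using span_remove_two[OF e(1,3) sub] by simp
  also have "\<dots> \<subseteq> span (d ` t)" using e r by (intro span_mono image_mono) auto
  finally show "span (d ` t) = span (d ` E)"
    using t by (meson antisym image_mono span_mono)
qed

text \<open>Deleting one edge from each circuit leaves a basis of the span, on which the products
  can be prescribed freely; the zero sums force the values at the two deleted edges.\<close>

lemma ex_vector_with_products:
  assumes "sum w A = 0" "sum w B = 0"
  shows "\<exists>a\<in>span (d ` E). \<forall>e\<in>E. a \<bullet> d e = w e"
proof -
  obtain eA eB where e: "eA \<in> A" "eB \<in> B" using ne by blast
  have neq: "eA \<noteq> eB" using e disj by auto
  let ?E = "E - {eA, eB}"
  have sp: "span (d ` ?E) = span (d ` E)"
    using span_remove_two[OF e sub] by simp
  have "card ?E + 2 = card E"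
  proof -
    have "{eA, eB} \<subseteq> E" using e sub by auto
    then show ?thesis
      using neq fin card_Diff_subset[of "{eA, eB}" E] card_mono[of E "{eA, eB}"] by simp
  qed
  then have cd: "card ?E = dim (d ` E)" using dim by linarith
  have "dim (d ` ?E) = dim (d ` E)" using sp by (metis dim_span)
  moreover have "dim (d ` ?E) \<le> card (d ` ?E)"
    using fin by (intro dim_le_card) (auto intro: span_base)
  moreover have "card (d ` ?E) \<le> card ?E" using fin by (intro card_image_le) auto
  ultimately have c: "card (d ` ?E) = card ?E" "card (d ` ?E) = dim (d ` ?E)"
    using cd by linarith+
  have inj: "inj_on d ?E" using c(1) fin by (intro eq_card_imp_inj_on) auto
  \<comment> \<open>A spanning set with as many elements as the dimension is independent.\<close>
  have ind: "independent (d ` ?E)"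
    using fin c(2) by (intro card_le_dim_spanning[of _ "d ` ?E"]) (auto intro: span_base)
  obtain g where g: "linear g" "\<forall>x\<in>d ` ?E. g x = w (the_inv_into ?E d x)"
    using linear_independent_extend[OF ind, of "\<lambda>x. w (the_inv_into ?E d x)"] by blast
  have gw: "g (d f) = w f" if "f \<in> ?E" for f
    using g(2) that inj by (auto simp: the_inv_into_f_f)
  \<comment> \<open>This vector represents the functional \<open>g\<close>; its projection to the
    span has the same products with all \<open>d e\<close>.\<close>
  define a0 where "a0 = adjoint g 1"
  have a0: "a0 \<bullet> x = g x" for x
    using adjoint_works[OF g(1), of x 1] by (simp add: a0_def inner_commute)
  obtain a z where az: "a \<in> span (d ` E)" "\<And>v. v \<in> span (d ` E) \<Longrightarrow> orthogonal z v" "a0 = a + z"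
    using orthogonal_subspace_decomp_exists[of "d ` E" a0] by blast
  have ad: "a \<bullet> d f = w f" if "f \<in> ?E" for f
  proof -
    have "z \<bullet> d f = 0" using az(2)[of "d f"] that by (auto simp: orthogonal_def intro: span_base)
    then show ?thesis using gw[OF that] a0[of "d f"] az(3) by (simp add: inner_add_left)
  qed
  \<comment> \<open>Over the circuit both the products and \<open>w\<close> sum to 0 and they agree
    off \<open>f\<close>, so they agree at \<open>f\<close>.\<close>
  have closing: "a \<bullet> d f = w f"
    if C: "finite C" "f \<in> C" "C - {f} \<subseteq> ?E" "sum d C = 0" "sum w C = 0" for C f
  proof -
    have "a \<bullet> d f + (\<Sum>h\<in>C - {f}. a \<bullet> d h) = 0"
      using sum.remove[OF C(1,2), of "\<lambda>h. a \<bullet> d h"] C(4) by (simp add: inner_sum_right[symmetric])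
    moreover have "(\<Sum>h\<in>C - {f}. a \<bullet> d h) = sum w (C - {f})"
      using C(3) ad by (intro sum.cong) auto
    moreover have "w f + sum w (C - {f}) = 0" using sum.remove[OF C(1,2), of w] C(5) by simp
    ultimately show ?thesis by linarith
  qed
  have "a \<bullet> d eA = w eA"
    using e disj sub finite_circuits sum0 assms by (intro closing[of A]) auto
  moreover have "a \<bullet> d eB = w eB"
    using e disj sub finite_circuits sum0 assms by (intro closing[of B]) auto
  ultimately show ?thesis using ad az(1) by (intro bexI[of _ a]) auto
qed

text \<open>Up to sign, the tight generators are the \<open>d e\<close> with
  \<open>\<bar>a \<bullet> d e\<bar> = 1\<close>, and signs do not change spans; so
  \<open>span_tight_iff\<close> rewrites the spanning condition.\<close>

lemma facet_normals_eq:
  "facet_normals (d ` E \<union> uminus ` d ` E) = {a \<in> span (d ` E). (\<forall>e\<in>E. \<bar>a \<bullet> d e\<bar> \<le> 1) \<and>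
     card {e \<in> A. \<bar>a \<bullet> d e\<bar> \<noteq> 1} \<le> 1 \<and> card {e \<in> B. \<bar>a \<bullet> d e\<bar> \<noteq> 1} \<le> 1 \<and>
     (\<forall>e\<in>E - A - B. \<bar>a \<bullet> d e\<bar> = 1)}"
proof -
  let ?S = "d ` E \<union> uminus ` d ` E"
  have spS: "span ?S = span (d ` E)"
    by (rule antisym; rule span_minimal) (auto intro: span_base span_neg)
  have tight: "span {s \<in> ?S. a \<bullet> s = 1} = span (d ` {e \<in> E. \<bar>a \<bullet> d e\<bar> = 1})" for a
  proof (rule antisym; rule span_minimal)
    have "d e \<in> span (d ` {e \<in> E. \<bar>a \<bullet> d e\<bar> = 1})" if "e \<in> E" "\<bar>a \<bullet> d e\<bar> = 1" for e
      using that by (intro span_base) auto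
    then show "{s \<in> ?S. a \<bullet> s = 1} \<subseteq> span (d ` {e \<in> E. \<bar>a \<bullet> d e\<bar> = 1})"
      by (auto intro!: span_neg)
    have "d e \<in> span {s \<in> ?S. a \<bullet> s = 1}" if "e \<in> E" "\<bar>a \<bullet> d e\<bar> = 1" for e
    proof (cases "a \<bullet> d e = 1")
      case True
      then show ?thesis using that by (intro span_base) auto
    next
      case False
      then have "- d e \<in> span {s \<in> ?S. a \<bullet> s = 1}" using that by (intro span_base) auto
      then show ?thesis using span_neg by fastforce
    qed
    then show "d ` {e \<in> E. \<bar>a \<bullet> d e\<bar> = 1} \<subseteq> span {s \<in> ?S. a \<bullet> s = 1}" by auto
  qed auto
  have bound: "(\<forall>s\<in>?S. a \<bullet> s \<le> 1) \<longleftrightarrow> (\<forall>e\<in>E. \<bar>a \<bullet> d e\<bar> \<le> 1)" for a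
    unfolding ball_Un ball_simps(9) by (auto simp: abs_le_iff inner_minus_right)
  have iff: "span (d ` {e \<in> E. \<bar>a \<bullet> d e\<bar> = 1}) = span (d ` E) \<longleftrightarrow>
     card {e \<in> A. \<bar>a \<bullet> d e\<bar> \<noteq> 1} \<le> 1 \<and> card {e \<in> B. \<bar>a \<bullet> d e\<bar> \<noteq> 1} \<le> 1 \<and>
     (\<forall>e\<in>E - A - B. \<bar>a \<bullet> d e\<bar> = 1)" for a
  proof -
    have "A - {e \<in> E. \<bar>a \<bullet> d e\<bar> = 1} = {e \<in> A. \<bar>a \<bullet> d e\<bar> \<noteq> 1}"
      "B - {e \<in> E. \<bar>a \<bullet> d e\<bar> = 1} = {e \<in> B. \<bar>a \<bullet> d e\<bar> \<noteq> 1}"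
      "E - A - B \<subseteq> {e \<in> E. \<bar>a \<bullet> d e\<bar> = 1} \<longleftrightarrow> (\<forall>e\<in>E - A - B. \<bar>a \<bullet> d e\<bar> = 1)"
      using sub by auto
    then show ?thesis using span_tight_iff[of "{e \<in> E. \<bar>a \<bullet> d e\<bar> = 1}"] by simp
  qed
  show ?thesis
    unfolding facet_normals_def spS tight bound iff ..
qed

text \<open>A normal lies in the span of the \<open>d e\<close>, so its products with them determine
  it. They split into independent labellings of \<open>A\<close>, \<open>B\<close> and the remaining
  edges, every combination being realised by \<open>ex_vector_with_products\<close>.\<close>

lemma card_facet_normals:
  "card (facet_normals (d ` E \<union> uminus ` d ` E)) =
     cycle_facets (card A) * cycle_facets (card B) * 2 ^ (card E - card A - card B)"
proof -
  let ?N = "facet_normals (d ` E \<union> uminus ` d ` E)"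
  let ?R = "E - A - B"
  let ?L = "cycle_labellings A \<times> cycle_labellings B \<times> (?R \<rightarrow>\<^sub>E {1, - 1 :: real})"
  define \<phi> where "\<phi> a = (\<lambda>e\<in>A. a \<bullet> d e, \<lambda>e\<in>B. a \<bullet> d e, \<lambda>e\<in>?R. a \<bullet> d e)" for a
  have agree: "restrict f C = restrict g C \<longleftrightarrow> (\<forall>e\<in>C. f e = g e)" for f g :: "'e \<Rightarrow> real" and C
    by (metis restrict_apply' restrict_ext)
  have "inj_on \<phi> ?N"
  proof (rule inj_onI)
    fix a b assume a: "a \<in> ?N" and b: "b \<in> ?N" and eq: "\<phi> a = \<phi> b"
    have ab: "a \<bullet> d e = b \<bullet> d e" if "e \<in> E" for e
      using eq that unfolding \<phi>_def prod.inject agree by blast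
    have mem: "a - b \<in> span (d ` E)"
      using a b unfolding facet_normals_eq by (auto intro: span_diff)
    have "orthogonal (a - b) (a - b)"
      by (rule orthogonal_to_span[OF mem]) (auto simp: orthogonal_def inner_diff_left ab)
    then show "a = b" by (simp add: orthogonal_self)
  qed
  moreover have "\<phi> ` ?N = ?L"
  proof (rule antisym)
    show "\<phi> ` ?N \<subseteq> ?L"
    proof (rule image_subsetI)
      fix a assume a: "a \<in> ?N"
      have lab: "(\<lambda>e\<in>C. a \<bullet> d e) \<in> cycle_labellings C"
        if "C \<subseteq> E" "sum d C = 0" "card {e \<in> C. \<bar>a \<bullet> d e\<bar> \<noteq> 1} \<le> 1" for C
      proof -
        have "{e \<in> C. \<bar>(\<lambda>e\<in>C. a \<bullet> d e) e\<bar> \<noteq> 1} = {e \<in> C. \<bar>a \<bullet> d e\<bar> \<noteq> 1}" by auto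
        moreover have "(\<Sum>e\<in>C. a \<bullet> d e) = 0"
          using that(2) by (simp add: inner_sum_right[symmetric])
        ultimately show ?thesis
          using that a unfolding facet_normals_eq cycle_labellings_def by auto
      qed
      have "(\<lambda>e\<in>A. a \<bullet> d e) \<in> cycle_labellings A" "(\<lambda>e\<in>B. a \<bullet> d e) \<in> cycle_labellings B"
        using a sub sum0 unfolding facet_normals_eq by (auto intro!: lab)
      moreover have "(\<lambda>e\<in>?R. a \<bullet> d e) \<in> ?R \<rightarrow>\<^sub>E {1, - 1}"
        using a unfolding facet_normals_eq by (auto simp: PiE_iff abs_if split: if_splits)
      ultimately show "\<phi> a \<in> ?L" by (simp add: \<phi>_def)
    qed
    show "?L \<subseteq> \<phi> ` ?N"
    proof
      fix p assume "p \<in> ?L"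
      then obtain x y z where p: "p = (x, y, z)" and x: "x \<in> cycle_labellings A"
        and y: "y \<in> cycle_labellings B" and z: "z \<in> ?R \<rightarrow>\<^sub>E {1, - 1}"
        by auto
      \<comment> \<open>The three labellings are glued to one; as the circuits are disjoint,
        \<open>w\<close> restricts to each of them.\<close>
      define w where "w e = (if e \<in> A then x e else if e \<in> B then y e else z e)" for e
      have wA: "w e = x e" if "e \<in> A" for e using that by (simp add: w_def)
      have wB: "w e = y e" if "e \<in> B" for e using that disj by (auto simp: w_def)
      have wR: "w e = z e" if "e \<in> ?R" for e using that by (auto simp: w_def)
      have x': "x \<in> extensional A" "\<forall>e\<in>A. \<bar>x e\<bar> \<le> 1" "sum x A = 0" "card {e \<in> A. \<bar>x e\<bar> \<noteq> 1} \<le> 1"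
        using x by (auto simp: cycle_labellings_def)
      have y': "y \<in> extensional B" "\<forall>e\<in>B. \<bar>y e\<bar> \<le> 1" "sum y B = 0" "card {e \<in> B. \<bar>y e\<bar> \<noteq> 1} \<le> 1"
        using y by (auto simp: cycle_labellings_def)
      have z': "z \<in> extensional ?R" "\<forall>e\<in>?R. \<bar>z e\<bar> = 1"
      proof -
        have "z e = 1 \<or> z e = - 1" if "e \<in> ?R" for e using z that by (auto simp: PiE_iff)
        then show "\<forall>e\<in>?R. \<bar>z e\<bar> = 1" by (metis abs_1 abs_minus)
      qed (use z in \<open>simp add: PiE_iff\<close>)
      have "sum w A = 0" "sum w B = 0" using wA wB x'(3) y'(3) by simp_all
      then obtain a where a: "a \<in> span (d ` E)" "\<forall>e\<in>E. a \<bullet> d e = w e"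
        using ex_vector_with_products by blast
      have aA: "a \<bullet> d e = x e" if "e \<in> A" for e using that a(2) wA sub by auto
      have aB: "a \<bullet> d e = y e" if "e \<in> B" for e using that a(2) wB sub by auto
      have aR: "a \<bullet> d e = z e" if "e \<in> ?R" for e using that a(2) wR by auto
      have "\<phi> a = p"
        unfolding \<phi>_def p prod.inject
        using x'(1) y'(1) z'(1) aA aB aR
        by (intro conjI; intro extensionalityI[where A = A] extensionalityI[where A = B]
            extensionalityI[where A = ?R]) auto
      moreover have "a \<in> ?N"
      proof -
        have "{e \<in> A. \<bar>a \<bullet> d e\<bar> \<noteq> 1} = {e \<in> A. \<bar>x e\<bar> \<noteq> 1}"
          "{e \<in> B. \<bar>a \<bullet> d e\<bar> \<noteq> 1} = {e \<in> B. \<bar>y e\<bar> \<noteq> 1}" using aA aB by auto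
        moreover have "\<bar>a \<bullet> d e\<bar> \<le> 1" if "e \<in> E" for e
          using that aA aB aR x'(2) y'(2) z'(2)
          by (metis DiffI order_refl)
        ultimately show ?thesis
          unfolding facet_normals_eq using a(1) x'(4) y'(4) aR z'(2) by simp
      qed
      ultimately show "p \<in> \<phi> ` ?N" by blast
    qed
  qed
  ultimately have "card ?N = card ?L" using card_image by metis
  also have "card (?R \<rightarrow>\<^sub>E {1, - 1 :: real}) = 2 ^ card ?R"
    using fin by (simp add: card_PiE numeral_2_eq_2)
  then have "card ?L = cycle_facets (card A) * cycle_facets (card B) * 2 ^ card ?R"
    using finite_circuits by (simp add: card_cartesian_product card_cycle_labellings)
  also have "card ?R = card E - card A - card B"
    using card_Diff_circuits[of "{}"] by simp
  finally show ?thesis .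
qed

lemma num_facets_eq:
  assumes "dim (d ` E) > 0"
  shows "num_facets (convex hull (d ` E \<union> uminus ` d ` E)) =
     cycle_facets (card A) * cycle_facets (card B) * 2 ^ (card E - card A - card B)"
proof -
  let ?S = "d ` E \<union> uminus ` d ` E"
  have "dim (d ` E) \<le> dim ?S" by (intro dim_subset) auto
  then have "num_facets (convex hull ?S) = card (facet_normals ?S)"
    using fin assms by (intro num_facets_symmetric_convex_hull) auto
  then show ?thesis using card_facet_normals by simp
qed

end

section \<open>Optimal cycle lengths\<close>

abbreviation odd_cycle_facets :: "nat \<Rightarrow> nat" where
  "odd_cycle_facets j \<equiv> cycle_facets (2 * j + 1)"

text \<open>Pascal's rule splits the central coefficient into two equal terms, to which the
  absorption identity applies.\<close>

lemma central_binomial_Suc: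
  "Suc j * ((2 * Suc j) choose Suc j) = 2 * (2 * j + 1) * ((2 * j) choose j)"
proof -
  have a: "Suc j * (Suc (2 * j) choose Suc j) = Suc (2 * j) * ((2 * j) choose j)"
    by (rule Suc_times_binomial)
  have "(2 * Suc j) choose Suc j = (Suc (2 * j) choose j) + (Suc (2 * j) choose Suc j)"
    by simp
  also have "Suc (2 * j) choose j = Suc (2 * j) choose Suc j"
    using binomial_symmetric[of j "Suc (2 * j)"] by simp
  finally have "Suc j * ((2 * Suc j) choose Suc j) = 2 * (Suc j * (Suc (2 * j) choose Suc j))"
    by simp
  then show ?thesis using a by simp
qed

lemma cycle_facets_odd: "odd_cycle_facets j = (2 * j + 1) * ((2 * j) choose j)"
  by (simp add: cycle_facets_def)

text \<open>The growth ratio of consecutive odd cycles, \<open>4 + 2 / (j + 1)\<close>, with the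
  denominator cleared.\<close>

lemma cycle_facets_odd_Suc: "Suc j * odd_cycle_facets (Suc j) = 2 * (2 * j + 3) * odd_cycle_facets j"
proof -
  have "Suc j * odd_cycle_facets (Suc j) = (2 * j + 3) * (Suc j * ((2 * Suc j) choose Suc j))"
    unfolding cycle_facets_odd by (simp add: algebra_simps)
  then show ?thesis
    unfolding central_binomial_Suc cycle_facets_odd by (simp only: mult_ac)
qed

text \<open>Shortening an even cycle by one edge is no loss if the released edge counts as a free
  sign, a factor 2.\<close>

lemma cycle_facets_even_le: "cycle_facets (2 * j + 2) \<le> 2 * odd_cycle_facets j"
proof -
  have "cycle_facets (2 * j + 2) = (2 * Suc j) choose Suc j"
    by (simp add: cycle_facets_def)
  also have "\<dots> \<le> Suc j * ((2 * Suc j) choose Suc j)" by simp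
  also have "\<dots> = 2 * odd_cycle_facets j"
    unfolding central_binomial_Suc cycle_facets_odd by simp
  finally show ?thesis .
qed

text \<open>Two free edges, a factor 4, are put to no worse use by lengthening an odd cycle by
  two.\<close>

lemma cycle_facets_odd_growth: "4 * odd_cycle_facets j \<le> odd_cycle_facets (Suc j)"
proof -
  have "Suc j * (4 * odd_cycle_facets j) \<le> Suc j * odd_cycle_facets (Suc j)"
    unfolding cycle_facets_odd_Suc by (simp add: algebra_simps)
  then show ?thesis by (simp only: nat_mult_le_cancel1 zero_less_Suc)
qed

lemma cycle_facets_odd_power: "4 ^ m * odd_cycle_facets j \<le> odd_cycle_facets (j + m)"
proof (induction m)
  case (Suc m)
  have "4 ^ Suc m * odd_cycle_facets j = 4 * (4 ^ m * odd_cycle_facets j)" by simp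
  also have "\<dots> \<le> 4 * odd_cycle_facets (j + m)" using Suc by (rule mult_le_mono2)
  also have "\<dots> \<le> odd_cycle_facets (j + Suc m)"
    using cycle_facets_odd_growth[of "j + m"] by simp
  finally show ?case .
qed simp

text \<open>The exponent is 1 exactly for even \<open>a\<close>, when one edge is released.\<close>

lemma cycle_facets_le_odd:
  assumes "a \<ge> 1"
  shows "cycle_facets a \<le> 2 ^ ((a - 1) mod 2) * odd_cycle_facets ((a - 1) div 2)"
proof (cases "even a")
  case True
  then obtain i where "a = 2 * i" by (rule evenE)
  with assms obtain j where "a = 2 * j + 2" by (cases i) auto
  then show ?thesis using cycle_facets_even_le[of j] by simp
next
  case False
  then obtain j where "a = 2 * j + 1" by (rule oddE)
  then show ?thesis by simp
qed

text \<open>The growth ratio decreases, so a step gains more on the shorter cycle. With denominators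
  cleared, this is \<open>Suc j * (2 * i + 3) \<le> Suc i * (2 * j + 3)\<close>.\<close>

lemma cycle_facets_balance_step:
  assumes "j \<le> i"
  shows "odd_cycle_facets (Suc i) * odd_cycle_facets j \<le> odd_cycle_facets i * odd_cycle_facets (Suc j)"
proof -
  let ?p = "odd_cycle_facets i * odd_cycle_facets j"
  have "(Suc i * Suc j) * (odd_cycle_facets (Suc i) * odd_cycle_facets j)
      = Suc j * (Suc i * odd_cycle_facets (Suc i)) * odd_cycle_facets j" by (simp only: mult_ac)
  also have "\<dots> = (2 * (Suc j * (2 * i + 3))) * ?p"
    unfolding cycle_facets_odd_Suc by (simp only: mult_ac)
  also have "\<dots> \<le> (2 * (Suc i * (2 * j + 3))) * ?p"
    using assms by (intro mult_le_mono1) (simp add: algebra_simps)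
  also have "\<dots> = Suc i * (Suc j * odd_cycle_facets (Suc j)) * odd_cycle_facets i"
    unfolding cycle_facets_odd_Suc by (simp only: mult_ac)
  also have "\<dots> = (Suc i * Suc j) * (odd_cycle_facets i * odd_cycle_facets (Suc j))"
    by (simp only: mult_ac)
  finally show ?thesis by (simp only: nat_mult_le_cancel1 zero_less_Suc nat_0_less_mult_iff simp_thms)
qed

text \<open>Moving one step from \<open>i\<close> to \<open>j\<close> keeps the sum and shrinks the
  gap, until the gap is at most 1.\<close>

lemma cycle_facets_balance:
  assumes "j \<le> i"
  shows "odd_cycle_facets i * odd_cycle_facets j
    \<le> odd_cycle_facets ((i + j + 1) div 2) * odd_cycle_facets ((i + j) div 2)"
  using assms
proof (induction "i - j" arbitrary: i j rule: less_induct)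
  case less
  show ?case
  proof (cases "i \<le> Suc j")
    case True
    then have "i = j \<or> i = Suc j" using less.prems by auto
    then have "(i + j + 1) div 2 = i" "(i + j) div 2 = j" by auto
    then show ?thesis by simp
  next
    case False
    then obtain i' where i: "i = Suc i'" by (cases i) auto
    have "odd_cycle_facets i * odd_cycle_facets j \<le> odd_cycle_facets i' * odd_cycle_facets (Suc j)"
      unfolding i using False i by (intro cycle_facets_balance_step) simp
    also have "\<dots> \<le> odd_cycle_facets ((i' + Suc j + 1) div 2) * odd_cycle_facets ((i' + Suc j) div 2)"
      using False i by (intro less.hyps) auto
    finally show ?thesis using i by simp
  qed
qed

text \<open>With the number of edges fixed, even cycles are made odd, the free edges are absorbed in
  pairs by the first cycle, and the lengths are balanced; \<open>q\<close> is the edge left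
  over.\<close>

lemma cycle_facets_product_le:
  assumes "a \<ge> 1" "b \<ge> 1" and N: "a + b + r = 2 * N + 2 + q" "q \<le> 1"
  shows "cycle_facets a * cycle_facets b * 2 ^ r
    \<le> odd_cycle_facets ((N + 1) div 2) * odd_cycle_facets (N div 2) * 2 ^ q"
proof -
  define i j where "i = (a - 1) div 2" and "j = (b - 1) div 2"
  define ra rb where "ra = (a - 1) mod 2" and "rb = (b - 1) mod 2"
  define s where "s = ra + rb + r"
  have "2 * i + ra + 1 = a" "2 * j + rb + 1 = b"
    using assms(1,2) by (simp_all add: i_def j_def ra_def rb_def)
  then have s: "2 * (i + j) + s = 2 * N + q" using N(1) by (simp add: s_def)
  define m where "m = N - (i + j)"
  \<comment> \<open>There are \<open>s\<close> free edges after shortening; as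
    \<open>q \<le> 1\<close>, it is the parity of \<open>s\<close>, and \<open>m\<close> pairs can
    be absorbed.\<close>
  have m: "s = 2 * m + q" "i + j + m = N" using s N(2) by (auto simp: m_def)
  have "cycle_facets a * cycle_facets b * 2 ^ r
     \<le> (2 ^ ra * odd_cycle_facets i) * (2 ^ rb * odd_cycle_facets j) * 2 ^ r"
    unfolding i_def j_def ra_def rb_def using assms by (intro mult_le_mono cycle_facets_le_odd) auto
  also have "\<dots> = 2 ^ s * (odd_cycle_facets i * odd_cycle_facets j)"
    unfolding s_def power_add by (simp only: mult_ac)
  also have "\<dots> = (4 ^ m * odd_cycle_facets i) * odd_cycle_facets j * 2 ^ q"
    unfolding m(1) power_add power_mult by (simp add: mult_ac)
  also have "\<dots> \<le> odd_cycle_facets (i + m) * odd_cycle_facets j * 2 ^ q"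
    by (intro mult_le_mono cycle_facets_odd_power) auto
  also have "\<dots> \<le> odd_cycle_facets ((N + 1) div 2) * odd_cycle_facets (N div 2) * 2 ^ q"
  proof (rule mult_le_mono1)
    \<comment> \<open>Balancing wants the larger index first, so the sum is needed in both
      orders.\<close>
    have N': "i + m + j = N" "j + (i + m) = N" using m by auto
    show "odd_cycle_facets (i + m) * odd_cycle_facets j
        \<le> odd_cycle_facets ((N + 1) div 2) * odd_cycle_facets (N div 2)"
    proof (cases "j \<le> i + m")
      case True
      from cycle_facets_balance[OF this] show ?thesis unfolding N' .
    next
      case False
      then have "i + m \<le> j" by simp
      from cycle_facets_balance[OF this] show ?thesis
        unfolding N' by (simp only: mult.commute)
    qed
  qed
  finally show ?thesis .
qed

section \<open>Bicyclic graphs\<close>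

text \<open>Each edge is oriented along the cycle, so the vectors telescope. From
  \<open>m \<ge> 3\<close> on, different positions give different edges, so a vector can be attached
  to the edge itself.\<close>

lemma cycle_orientation:
  fixes C :: "'v::finite ugraph"
  assumes C: "is_cycle m C" and m: "m \<ge> 3"
  shows "card (edges C) = m \<and> (\<exists>d :: 'v set \<Rightarrow> real ^ 'v. sum d (edges C) = 0 \<and>
    (\<forall>e\<in>edges C. \<exists>i j. i \<noteq> j \<and> e = {i, j} \<and> d e = axis i 1 - axis j 1))"
proof -
  obtain xs where xs: "length xs = m" "distinct xs"
    "edges C = {{xs ! i, xs ! (Suc i mod m)} | i. i < m}"
    using C unfolding is_cycle_def by blast
  define ed where "ed i = {xs ! i, xs ! (Suc i mod m)}" for i
  define v where "v i = (axis (xs ! i) 1 :: real ^ 'v)" for i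
  have edges: "edges C = ed ` {..<m}" unfolding xs(3) ed_def by auto
  have nth: "xs ! i = xs ! j \<longleftrightarrow> i = j" if "i < m" "j < m" for i j
    using that xs by (simp add: nth_eq_iff_index_eq)
  have modm: "Suc i mod m < m" for i using m by simp
  have inj: "inj_on ed {..<m}"
  proof (rule inj_onI)
    fix i j assume ij: "i \<in> {..<m}" "j \<in> {..<m}" and eq: "ed i = ed j"
    \<comment> \<open>A coincidence of two edges would make each position the successor of the
      other, which happens only for \<open>m = 2\<close>.\<close>
    have "i = j \<or> i = Suc j mod m \<and> j = Suc i mod m"
      using eq ij nth modm unfolding ed_def doubleton_eq_iff by (metis lessThan_iff)
    then show "i = j"
      using ij m by (auto simp: mod_Suc split: if_splits)
  qed
  define d where "d e = (let i = the_inv_into {..<m} ed e in v i - v (Suc i mod m))" for e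
  have d: "d (ed i) = v i - v (Suc i mod m)" if "i < m" for i
    using that inj by (simp add: d_def the_inv_into_f_f)
  obtain k where k: "m = Suc k" using m by (cases m) auto
  \<comment> \<open>The cyclic shift permutes the summands: only the last index wraps around, to
    0.\<close>
  have "(\<Sum>i<m. v (Suc i mod m)) = (\<Sum>i<k. v (Suc i)) + v 0"
    unfolding k by simp
  also have "\<dots> = (\<Sum>i<m. v i)"
    unfolding k by (simp only: sum.lessThan_Suc_shift add.commute)
  finally have "(\<Sum>i<m. v i - v (Suc i mod m)) = 0" by (simp add: sum_subtractf)
  moreover have "sum d (edges C) = (\<Sum>i<m. v i - v (Suc i mod m))"
    unfolding edges sum.reindex[OF inj] by (intro sum.cong) (auto simp: d)
  ultimately have "sum d (edges C) = 0" by simp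
  moreover have "\<exists>i j. i \<noteq> j \<and> e = {i, j} \<and> d e = axis i 1 - axis j 1" if e: "e \<in> edges C" for e
  proof -
    obtain i where i: "i < m" "e = ed i" using e edges by auto
    have "i \<noteq> Suc i mod m" using i m by (auto simp: mod_Suc)
    then have "xs ! i \<noteq> xs ! (Suc i mod m)" using nth i modm by simp
    then show ?thesis using d[OF i(1)] i(2) unfolding ed_def v_def by blast
  qed
  moreover have "card (edges C) = m" unfolding edges by (simp add: card_image inj)
  ultimately show ?thesis by blast
qed

text \<open>The span is the hyperplane of vectors with coordinate sum 0: telescoping along paths
  gives all differences of basis vectors.\<close>

lemma dim_edge_vectors:
  fixes G :: "'v::finite ugraph"
  assumes conn: "connected_graph G" and V: "verts G = UNIV"
    and d: "\<And>e. e \<in> edges G \<Longrightarrow> \<exists>i j. i \<noteq> j \<and> e = {i, j} \<and> d e = axis i 1 - (axis j 1 :: real ^ 'v)"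
  shows "dim (d ` edges G) + 1 = CARD('v)"
proof -
  let ?S = "span (d ` edges G)"
  let ?one = "(\<chi> i. 1) :: real ^ 'v"
  have edge: "axis i 1 - axis j 1 \<in> ?S" if e: "{i, j} \<in> edges G" for i j
  proof -
    obtain i' j' where "{i, j} = {i', j'}" "d {i, j} = axis i' 1 - axis j' 1"
      using d[OF e] by blast
    then have "axis i 1 - axis j 1 = d {i, j} \<or> axis i 1 - axis j 1 = - d {i, j}"
      by (auto simp: doubleton_eq_iff)
    moreover have "d {i, j} \<in> ?S" using e by (intro span_base) auto
    ultimately show ?thesis by (auto intro: span_neg)
  qed
  have path: "axis u 1 - axis w 1 \<in> ?S" for u w
  proof -
    have "(u, w) \<in> {(x, y). {x, y} \<in> edges G}\<^sup>*" using conn V by (auto simp: connected_graph_def)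
    then show ?thesis
    proof induction
      case (step y z)
      then have "(axis u 1 - axis y 1) + (axis y 1 - axis z 1) \<in> ?S"
        using edge by (intro span_add) auto
      then show ?case by simp
    qed (simp add: span_zero)
  qed
  have "{x. ?one \<bullet> x = 0} \<subseteq> ?S"
  proof
    fix x :: "real ^ 'v" assume "x \<in> {x. ?one \<bullet> x = 0}"
    then have x0: "(\<Sum>i\<in>UNIV. x $ i) = 0" by (simp add: inner_vec_def)
    \<comment> \<open>An arbitrary base vertex; subtracting its basis vector below changes nothing
      since the coordinates sum to 0.\<close>
    obtain w :: 'v where True by blast
    have "x = (\<Sum>i\<in>UNIV. x $ i *\<^sub>R axis i 1)"
      using basis_expansion[of x] by (simp add: scalar_mult_eq_scaleR)
    also have "\<dots> = (\<Sum>i\<in>UNIV. x $ i *\<^sub>R (axis i 1 - axis w 1))"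
      using x0 by (simp add: scaleR_diff_right sum_subtractf scaleR_sum_left[symmetric])
    also have "\<dots> \<in> ?S" by (intro span_sum span_scale path)
    finally show "x \<in> ?S" .
  qed
  moreover have "?S \<subseteq> {x. ?one \<bullet> x = 0}"
  proof (rule span_minimal)
    show "d ` edges G \<subseteq> {x. ?one \<bullet> x = 0}"
    proof (rule image_subsetI)
      fix e assume "e \<in> edges G"
      then obtain i j where "d e = axis i 1 - axis j 1" using d by blast
      then show "d e \<in> {x. ?one \<bullet> x = 0}" by (simp add: inner_diff_right inner_axis)
    qed
  qed (rule subspace_hyperplane)
  ultimately have "?S = {x. ?one \<bullet> x = 0}" by auto
  moreover have "?one \<noteq> 0" by (simp add: vec_eq_iff)
  ultimately have "dim ?S = CARD('v) - 1" using dim_hyperplane[of ?one] by simp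
  then show ?thesis by (simp add: dim_span)
qed

text \<open>Reversing the order of the two ends only changes the sign of a generator, so one
  orientation per edge together with its negative suffices.\<close>

lemma sym_edge_polytope_oriented:
  assumes d: "\<And>e. e \<in> edges G \<Longrightarrow> \<exists>i j. i \<noteq> j \<and> e = {i, j} \<and> d e = axis i 1 - axis j 1"
  shows "sym_edge_polytope G = convex hull (d ` edges G \<union> uminus ` d ` edges G)"
proof -
  let ?D = "d ` edges G \<union> uminus ` d ` edges G"
  let ?V = "{axis i 1 - axis j 1 | i j. {i, j} \<in> edges G}
    \<union> {- (axis i 1 - axis j 1) | i j. {i, j} \<in> edges G}"
  have "axis i 1 - axis j 1 \<in> ?D \<and> - (axis i 1 - axis j 1) \<in> ?D" if e: "{i, j} \<in> edges G" for i j
  proof -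
    obtain i' j' where "{i, j} = {i', j'}" "d {i, j} = axis i' 1 - axis j' 1"
      using d[OF e] by blast
    then have "axis i 1 - axis j 1 = d {i, j} \<or> axis i 1 - axis j 1 = - d {i, j}"
      by (auto simp: doubleton_eq_iff)
    moreover have "d {i, j} \<in> ?D" "- d {i, j} \<in> ?D" using e by auto
    ultimately show ?thesis by (metis minus_minus)
  qed
  then have "?V \<subseteq> ?D" by blast
  moreover have "d e \<in> ?V \<and> - d e \<in> ?V" if e: "e \<in> edges G" for e
  proof -
    obtain i j where "e = {i, j}" "d e = axis i 1 - axis j 1" using d[OF e] by blast
    then show ?thesis using e by fastforce
  qed
  then have "?D \<subseteq> ?V" by blast
  ultimately have "?V = ?D" by (rule antisym)
  then show ?thesis unfolding sym_edge_polytope_def by (rule arg_cong)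
qed

text \<open>Covers both \<open>H\<close> and the wedges of two cycles of length at least 3; how the
  two cycles meet or are joined is left open, as it does not affect the facet number.\<close>

definition bicyclic :: "nat \<Rightarrow> nat \<Rightarrow> 'v ugraph \<Rightarrow> bool" where
  "bicyclic k l G \<longleftrightarrow> simple_graph G \<and> connected_graph G \<and> card (edges G) = card (verts G) + 1 \<and>
     k \<ge> 3 \<and> l \<ge> 3 \<and> (\<exists>A B. is_cycle k A \<and> is_cycle l B \<and> edges A \<subseteq> edges G \<and> edges B \<subseteq> edges G \<and>
        edges A \<inter> edges B = {})"

text \<open>Connectedness gives rank \<open>n - 1\<close> against \<open>n + 1\<close> edges, so
  \<open>two_circuits\<close> applies and the facet number depends only on the two lengths and
  \<open>n\<close>.\<close>

lemma num_facets_bicyclic: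
  fixes G :: "'v::finite ugraph"
  assumes G: "bicyclic k l G" and V: "verts G = UNIV"
  shows "k + l \<le> CARD('v) + 1 \<and> num_facets (sym_edge_polytope G) =
    cycle_facets k * cycle_facets l * 2 ^ (CARD('v) + 1 - (k + l))"
proof -
  obtain A B where AB: "is_cycle k A" "is_cycle l B" "edges A \<subseteq> edges G" "edges B \<subseteq> edges G"
    "edges A \<inter> edges B = {}" and kl: "k \<ge> 3" "l \<ge> 3"
    using G unfolding bicyclic_def by blast
  have cE: "card (edges G) = CARD('v) + 1" and conn: "connected_graph G"
    using G V unfolding bicyclic_def by auto
  have G2: "card e = 2" if "e \<in> edges G" for e
    using G that unfolding bicyclic_def simple_graph_def by blast
  obtain dA :: "'v set \<Rightarrow> real ^ 'v" where A: "card (edges A) = k" "sum dA (edges A) = 0"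
    "\<forall>e\<in>edges A. \<exists>i j. i \<noteq> j \<and> e = {i, j} \<and> dA e = axis i 1 - axis j 1"
    using cycle_orientation[OF AB(1) kl(1)] by blast
  obtain dB :: "'v set \<Rightarrow> real ^ 'v" where B: "card (edges B) = l" "sum dB (edges B) = 0"
    "\<forall>e\<in>edges B. \<exists>i j. i \<noteq> j \<and> e = {i, j} \<and> dB e = axis i 1 - axis j 1"
    using cycle_orientation[OF AB(2) kl(2)] by blast
  have "\<forall>e\<in>edges G. \<exists>y::real ^ 'v. \<exists>i j. i \<noteq> j \<and> e = {i, j} \<and> y = axis i 1 - axis j 1"
  proof
    fix e assume "e \<in> edges G"
    then obtain i j where "e = {i, j}" "i \<noteq> j" using G2 card_2_iff by meson
    then show "\<exists>y::real ^ 'v. \<exists>i j. i \<noteq> j \<and> e = {i, j} \<and> y = axis i 1 - axis j 1" by blast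
  qed
  from bchoice[OF this] obtain dR :: "'v set \<Rightarrow> real ^ 'v" where
    R: "\<forall>e\<in>edges G. \<exists>i j. i \<noteq> j \<and> e = {i, j} \<and> dR e = axis i 1 - axis j 1"
    by (elim exE)
  \<comment> \<open>Edges follow the orientation of their cycle and are oriented arbitrarily
    elsewhere; disjointness prevents a conflict.\<close>
  define d where "d e = (if e \<in> edges A then dA e else if e \<in> edges B then dB e else dR e)" for e
  have d: "\<exists>i j. i \<noteq> j \<and> e = {i, j} \<and> d e = axis i 1 - axis j 1" if "e \<in> edges G" for e
    using that A(3) B(3) R unfolding d_def by presburger
  have "sum d (edges A) = sum dA (edges A)" by (intro sum.cong) (auto simp: d_def)
  moreover have "sum d (edges B) = sum dB (edges B)"
    using AB(5) by (intro sum.cong) (auto simp: d_def)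
  ultimately have s: "sum d (edges A) = 0" "sum d (edges B) = 0" using A(2) B(2) by simp_all
  have dim: "dim (d ` edges G) + 1 = CARD('v)"
    using conn V d by (rule dim_edge_vectors)
  have le: "k + l \<le> CARD('v) + 1"
    using card_Un_disjoint[of "edges A" "edges B"] card_mono[of "edges G" "edges A \<union> edges B"]
      AB A(1) B(1) cE by simp
  have pos: "dim (d ` edges G) > 0" using dim le kl by linarith
  interpret two_circuits "edges G" "edges A" "edges B" d
  proof
    show "edges A \<noteq> {}" "edges B \<noteq> {}" using A(1) B(1) kl by auto
  qed (use AB s dim cE in auto)
  have "num_facets (sym_edge_polytope G) = cycle_facets k * cycle_facets l *
      2 ^ (card (edges G) - card (edges A) - card (edges B))"
    using num_facets_eq[OF pos] sym_edge_polytope_oriented[of G d, OF d] A(1) B(1) by simp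
  then show ?thesis using le unfolding cE A(1) B(1) diff_diff_left by simp
qed

section \<open>Wedges of cycles as bicyclic graphs\<close>

lemma is_cycle_simple_connected:
  assumes C: "is_cycle m C" and m: "m \<ge> 3"
  shows "simple_graph C" "connected_graph C" "card (verts C) = m"
proof -
  obtain xs where xs: "length xs = m" "distinct xs" "verts C = set xs"
    "edges C = {{xs ! i, xs ! (Suc i mod m)} | i. i < m}"
    using C unfolding is_cycle_def by blast
  show "card (verts C) = m" using xs distinct_card by metis
  have "e \<subseteq> verts C \<and> card e = 2" if e: "e \<in> edges C" for e
  proof -
    obtain i where i: "i < m" "e = {xs ! i, xs ! (Suc i mod m)}" using e xs(4) by auto
    have j: "Suc i mod m < m" "i \<noteq> Suc i mod m" using i m by (auto simp: mod_Suc)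
    then have "xs ! i \<noteq> xs ! (Suc i mod m)" using i xs by (simp add: nth_eq_iff_index_eq)
    then show ?thesis using i j xs by auto
  qed
  then show "simple_graph C" unfolding simple_graph_def using xs(3) by simp
  let ?R = "{(x, y). {x, y} \<in> edges C}"
  have reach: "(xs ! 0, xs ! i) \<in> ?R\<^sup>*" if "i < m" for i
    using that
  proof (induction i)
    case (Suc i)
    have "{xs ! i, xs ! (Suc i mod m)} \<in> edges C" using Suc.prems xs(4) by auto
    then have "(xs ! i, xs ! Suc i) \<in> ?R" using Suc.prems by simp
    then show ?case using Suc by (meson Suc_lessD rtrancl.rtrancl_into_rtrancl)
  qed simp
  have "sym (?R\<^sup>*)" by (intro sym_rtrancl) (auto simp: sym_def insert_commute)
  have "(u, w) \<in> ?R\<^sup>*" if uw: "u \<in> set xs" "w \<in> set xs" for u w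
  proof -
    have "(xs ! 0, u) \<in> ?R\<^sup>*" "(xs ! 0, w) \<in> ?R\<^sup>*"
      using uw reach xs(1) by (auto simp: in_set_conv_nth)
    then show ?thesis using \<open>sym (?R\<^sup>*)\<close> by (meson rtrancl_trans symD)
  qed
  moreover have "set xs \<noteq> {}" using xs(1) m by auto
  ultimately show "connected_graph C" unfolding connected_graph_def xs(3) by blast
qed

lemma wedge_simple_connected:
  assumes W: "is_wedge G A B" and A: "simple_graph A" "connected_graph A"
    and B: "simple_graph B" "connected_graph B"
  shows "simple_graph G" "connected_graph G" "edges A \<inter> edges B = {}"
    "card (verts G) + 1 = card (verts A) + card (verts B)"
    "card (edges G) = card (edges A) + card (edges B)"
proof -
  obtain v where v: "verts A \<inter> verts B = {v}"
    and G: "verts G = verts A \<union> verts B" "edges G = edges A \<union> edges B"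
    using W unfolding is_wedge_def by blast
  have fin: "finite (verts A)" "finite (verts B)" using A B unfolding simple_graph_def by auto
  show "simple_graph G" using A B G unfolding simple_graph_def by auto
  \<comment> \<open>A common edge would have both of its ends in the one shared vertex.\<close>
  show disj: "edges A \<inter> edges B = {}"
  proof (rule ccontr)
    assume "edges A \<inter> edges B \<noteq> {}"
    then obtain e where "e \<in> edges A" "e \<in> edges B" by auto
    then have "e \<subseteq> {v}" "card e = 2" using A B v unfolding simple_graph_def by blast+
    then show False using card_mono[of "{v}" e] by simp
  qed
  have "edges A \<subseteq> Pow (verts A)" "edges B \<subseteq> Pow (verts B)"
    using A B unfolding simple_graph_def by auto
  then have "finite (edges A)" "finite (edges B)" using fin by (meson finite_Pow_iff finite_subset)+
  then show "card (edges G) = card (edges A) + card (edges B)"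
    unfolding G by (simp add: card_Un_disjoint disj)
  show "card (verts G) + 1 = card (verts A) + card (verts B)"
    using card_Un_Int[OF fin] v G by simp
  let ?RA = "{(x, y). {x, y} \<in> edges A}" and ?RB = "{(x, y). {x, y} \<in> edges B}"
    and ?R = "{(x, y). {x, y} \<in> edges G}"
  have "?RA \<subseteq> ?R" "?RB \<subseteq> ?R" using G(2) by auto
  then have mono: "?RA\<^sup>* \<subseteq> ?R\<^sup>*" "?RB\<^sup>* \<subseteq> ?R\<^sup>*" by (auto intro: rtrancl_mono[THEN subsetD])
  have vA: "(u, v) \<in> ?R\<^sup>* \<and> (v, u) \<in> ?R\<^sup>*" if "u \<in> verts A" for u
    using that A(2) v mono(1) unfolding connected_graph_def by blast
  have vB: "(u, v) \<in> ?R\<^sup>* \<and> (v, u) \<in> ?R\<^sup>*" if "u \<in> verts B" for u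
    using that B(2) v mono(2) unfolding connected_graph_def by blast
  have "(u, w) \<in> ?R\<^sup>*" if uw: "u \<in> verts G" "w \<in> verts G" for u w
  proof (rule rtrancl_trans)
    show "(u, v) \<in> ?R\<^sup>*" "(v, w) \<in> ?R\<^sup>*" using uw vA vB G(1) by auto
  qed
  then show "connected_graph G" unfolding connected_graph_def using v G by blast
qed

lemma single_edge_simple_connected:
  assumes "is_single_edge G"
  shows "simple_graph G" "connected_graph G" "card (verts G) = 2" "card (edges G) = 1"
proof -
  obtain u v where uv: "u \<noteq> v" "G = Graph {u, v} {{u, v}}"
    using assms unfolding is_single_edge_def by blast
  then show "simple_graph G" "card (verts G) = 2" "card (edges G) = 1"
    by (auto simp: simple_graph_def)
  have "(u, v) \<in> {(x, y). {x, y} \<in> edges G}" "(v, u) \<in> {(x, y). {x, y} \<in> edges G}"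
    using uv by auto
  then have "(u, v) \<in> {(x, y). {x, y} \<in> edges G}\<^sup>*" "(v, u) \<in> {(x, y). {x, y} \<in> edges G}\<^sup>*"
    by (simp_all only: r_into_rtrancl)
  then show "connected_graph G"
    unfolding connected_graph_def using uv(2) by auto
qed

lemma wedge_of_cycles_bicyclic:
  fixes G :: "'v::finite ugraph"
  assumes "is_wedge_of_cycles k l G" and kl: "k \<ge> 3" "l \<ge> 3"
  shows "bicyclic k l G \<and> card (verts G) + 1 = k + l"
proof -
  obtain A B where AB: "is_cycle k A" "is_cycle l B" "is_wedge G A B"
    using assms(1) unfolding is_wedge_of_cycles_def by blast
  note A = is_cycle_simple_connected[OF AB(1) kl(1)] and B = is_cycle_simple_connected[OF AB(2) kl(2)]
  note G = wedge_simple_connected[OF AB(3) A(1,2) B(1,2)]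
  have "card (edges A) = k" "card (edges B) = l"
    using cycle_orientation AB kl by blast+
  moreover have "edges A \<subseteq> edges G" "edges B \<subseteq> edges G" using AB(3) unfolding is_wedge_def by auto
  ultimately show ?thesis unfolding bicyclic_def using AB A B G kl by auto
qed

lemma wedge_of_cycles_edge_bicyclic:
  fixes G :: "'v::finite ugraph"
  assumes "is_wedge_of_cycles_edge k l G" and kl: "k \<ge> 3" "l \<ge> 3"
  shows "bicyclic k l G \<and> card (verts G) = k + l"
proof -
  obtain A B where AB: "is_wedge_of_cycles k l A" "is_single_edge B" "is_wedge G A B"
    using assms(1) unfolding is_wedge_of_cycles_edge_def by blast
  have A: "bicyclic k l A" "card (verts A) + 1 = k + l"
    using wedge_of_cycles_bicyclic[OF AB(1) kl] by auto
  have A': "simple_graph A" "connected_graph A" using A(1) unfolding bicyclic_def by auto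
  note B = single_edge_simple_connected[OF AB(2)]
  note G = wedge_simple_connected[OF AB(3) A' B(1,2)]
  have "edges A \<subseteq> edges G" using AB(3) unfolding is_wedge_def by auto
  then show ?thesis using A B G unfolding bicyclic_def by auto
qed

text \<open>With \<open>N = k - 1\<close>, rounding \<open>N / 2\<close> up and down turns the four
  cases into one: the lengths are \<open>k + 1\<close> and \<open>k - 1\<close> for even
  \<open>k\<close>, and \<open>k\<close> twice for odd \<open>k\<close>. The edge \<open>e\<close>
  is recorded by \<open>q\<close>.\<close>

lemma M_graph_bicyclic:
  fixes G :: "'v::finite ugraph"
  assumes G: "is_M_graph CARD('v) G" and n: "CARD('v) \<ge> 5"
  obtains N q where "CARD('v) + 1 = 2 * N + 2 + q" "q \<le> 1" "verts G = UNIV"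
    "bicyclic (2 * ((N + 1) div 2) + 1) (2 * (N div 2) + 1) G"
proof -
  have full: "verts G = UNIV" if "card (verts G) = CARD('v)"
    using that by (intro card_subset_eq) auto
  from G obtain k where "(CARD('v) + 1 = 2 * k \<and> even k \<and> is_wedge_of_cycles (k + 1) (k - 1) G) \<or>
     (CARD('v) + 1 = 2 * k \<and> odd k \<and> is_wedge_of_cycles k k G) \<or>
     (CARD('v) = 2 * k \<and> even k \<and> is_wedge_of_cycles_edge (k + 1) (k - 1) G) \<or>
     (CARD('v) = 2 * k \<and> odd k \<and> is_wedge_of_cycles_edge k k G)"
    unfolding is_M_graph_def by (elim exE)
  then consider
      (a) "CARD('v) + 1 = 2 * k" "even k" "is_wedge_of_cycles (k + 1) (k - 1) G"
    | (b) "CARD('v) + 1 = 2 * k" "odd k" "is_wedge_of_cycles k k G"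
    | (c) "CARD('v) = 2 * k" "even k" "is_wedge_of_cycles_edge (k + 1) (k - 1) G"
    | (d) "CARD('v) = 2 * k" "odd k" "is_wedge_of_cycles_edge k k G"
    by blast
  then show ?thesis
  proof cases
    case a
    \<comment> \<open>This excludes \<open>k = 2\<close>, where the second cycle would be a loop and
      the graph would not be simple.\<close>
    have "k \<ge> 4" using a n by presburger
    with wedge_of_cycles_bicyclic[OF a(3)] have *: "bicyclic (k + 1) (k - 1) G" "card (verts G) + 1 = 2 * k"
      by auto
    have "2 * ((k - 1 + 1) div 2) + 1 = k + 1" "2 * ((k - 1) div 2) + 1 = k - 1"
      using a(2) \<open>k \<ge> 4\<close> by presburger+
    then show ?thesis using that[of "k - 1" 0] * full a(1) \<open>k \<ge> 4\<close> by simp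
  next
    case b
    have "k \<ge> 3" using b n by presburger
    with wedge_of_cycles_bicyclic[OF b(3)] have *: "bicyclic k k G" "card (verts G) + 1 = 2 * k"
      by auto
    have "2 * ((k - 1 + 1) div 2) + 1 = k" "2 * ((k - 1) div 2) + 1 = k"
      using b(2) \<open>k \<ge> 3\<close> by presburger+
    then show ?thesis using that[of "k - 1" 0] * full b(1) \<open>k \<ge> 3\<close> by simp
  next
    case c
    have "k \<ge> 4" using c n by presburger
    with wedge_of_cycles_edge_bicyclic[OF c(3)] have *: "bicyclic (k + 1) (k - 1) G" "card (verts G) = 2 * k"
      by auto
    have "2 * ((k - 1 + 1) div 2) + 1 = k + 1" "2 * ((k - 1) div 2) + 1 = k - 1"
      using c(2) \<open>k \<ge> 4\<close> by presburger+
    then show ?thesis using that[of "k - 1" 1] * full c(1) \<open>k \<ge> 4\<close> by simp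
  next
    case d
    have "k \<ge> 3" using d n by presburger
    with wedge_of_cycles_edge_bicyclic[OF d(3)] have *: "bicyclic k k G" "card (verts G) = 2 * k"
      by auto
    have "2 * ((k - 1 + 1) div 2) + 1 = k" "2 * ((k - 1) div 2) + 1 = k"
      using d(2) \<open>k \<ge> 3\<close> by presburger+
    then show ?thesis using that[of "k - 1" 1] * full d(1) \<open>k \<ge> 3\<close> by simp
  qed
qed

theorem theorem3p4:
  fixes H :: "'n::finite ugraph"
  assumes "CARD('n) \<ge> 3"
    and "simple_graph H"
    and "verts H = UNIV"
    and "connected_graph H"
    and "card (edges H) = CARD('n) + 1"
    and "has_two_edge_disjoint_cycles H"
  shows "num_facets (sym_edge_polytope H) \<le> M_facets TYPE('n)"
proof -
  obtain a b where ab: "bicyclic a b H" "a \<ge> 3" "b \<ge> 3"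
    using assms(2-6) unfolding has_two_edge_disjoint_cycles_def bicyclic_def subgraph_of_def
    by (metis (no_types, lifting))
  have H: "a + b \<le> CARD('n) + 1" "num_facets (sym_edge_polytope H) =
      cycle_facets a * cycle_facets b * 2 ^ (CARD('n) + 1 - (a + b))"
    using num_facets_bicyclic[OF ab(1) assms(3)] by auto
  \<comment> \<open>Whichever graph is chosen here, its cycle lengths are determined by
    \<open>n\<close>, and so is its facet number.\<close>
  define G :: "'n ugraph" where "G = (SOME G. is_M_graph CARD('n) G)"
  have "is_M_graph CARD('n) G"
    unfolding G_def using ex_M_graph[where 'v = 'n] assms(1) by (metis someI_ex)
  \<comment> \<open>Two edge-disjoint cycles use at least six of the \<open>n + 1\<close> edges, so
    smaller \<open>n\<close> cannot occur.\<close>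
  moreover have "CARD('n) \<ge> 5" using H(1) ab by linarith
  ultimately obtain N q where N: "CARD('n) + 1 = 2 * N + 2 + q" "q \<le> 1" "verts G = UNIV"
    "bicyclic (2 * ((N + 1) div 2) + 1) (2 * (N div 2) + 1) G"
    by (rule M_graph_bicyclic)
  \<comment> \<open>The cycles of \<open>G\<close> use \<open>2 * N + 2\<close> of the
    \<open>n + 1\<close> edges, which leaves \<open>q\<close> for the power of 2.\<close>
  have "2 * ((N + 1) div 2) + 1 + (2 * (N div 2) + 1) = 2 * N + 2" by presburger
  then have "num_facets (sym_edge_polytope G) =
      odd_cycle_facets ((N + 1) div 2) * odd_cycle_facets (N div 2) * 2 ^ q"
    using num_facets_bicyclic[OF N(4,3)] N(1) by simp
  moreover have "cycle_facets a * cycle_facets b * 2 ^ (CARD('n) + 1 - (a + b))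
      \<le> odd_cycle_facets ((N + 1) div 2) * odd_cycle_facets (N div 2) * 2 ^ q"
    using H(1) ab(2,3) N(1,2) by (intro cycle_facets_product_le) auto
  ultimately show ?thesis
    unfolding M_facets_def G_def[symmetric] H(2) by simp
qed

end
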